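(* Let $L>0$, $\lambda>0$, $l\ge2$ an integer, and let real coefficients $a_{l+j,l-j},b_{l+j,l-j}$ ($j=1,\dots,l-1$) satisfy the Coefficient Conditions. Then for every $f\in L^2(0,L)$ the boundary value problem $$\lambda u+\sum_{j=1}^{l}(-1)^{j+1}D^{2j+1}u=f\quad\text{in }(0,L),$$ together with the Boundary Conditions, admits a unique solution $u\in H^{2l+1}(0,L)$, and $$\|u\|_{H^{2l+1}(0,L)}\le C\|f\|_{L^2(0,L)}$$ with a constant $C$ depending only on $L$, $l$, $\lambda$ and the coefficients $a_{l+j,l-j}$, $b_{l+j,l-j}$.
   Context: $D^i=\frac{d^i}{dx^i}$; $H^m(0,L)$ is the Sobolev space with norm $\|u\|_{H^m}^2=\sum_{j=0}^m\|D^ju\|_{L^2}^2$ (functions in $H^{2l+1}(0,L)$ have continuous derivatives up to order $2l$ on $[0,L]$, so the boundary conditions make sense). Boundary Conditions: $u(0)=u(L)=D^lu(L)=0$; $D^{l+j}u(0)=a_{l+j,l-j}D^{l-j}u(0)$ and $D^{l+j}u(L)=b_{l+j,l-j}D^{l-j}u(L)$ for $j=1,\dots,l-1$. Coefficient Conditions: - If $l=2$: $b_{3,1}>\tfrac12$ and $a_{3,1}<\tfrac12$. - If $l=3$: $b_{5,1}<-\tfrac12$, $b_{4,2}>\tfrac12$, $a_{5,1}>\tfrac12$, $a_{4,2}<\tfrac12$. - If $l\ge4$: $b_{l+1,l-1}>l-2$, $b_{l+2,l-2}<2-l$, $a_{l+1,l-1}<5-2l$, $a_{l+2,l-2}>2l-5$;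 for odd $j$ with $3\le j\le l-1$: $b_{l+j,l-j}>l-2+\frac12\big(\sum_{m=1}^{(j-1)/2}|b_{l+2m-1,l-2m+1}|\big)^2$ and $a_{l+j,l-j}<5-2l-\frac12\big(\sum_{m=1}^{(j-1)/2}|a_{l+2m-1,l-2m+1}|\big)^2$; for even $j$ with $4\le j\le l-1$: $b_{l+j,l-j}<2-l-\frac12\big(\sum_{m=1}^{j/2-1}|b_{l+2m,l-2m}|\big)^2$ and $a_{l+j,l-j}>2l-5+\frac12\big(\sum_{m=1}^{j/2-1}|a_{l+2m,l-2m}|\big)^2$. *)

theory Defs
  imports "HOL-Analysis.Analysis"
begin

text \<open>Sobolev space H^m(0,L) on an interval, via continuous representatives:
  du k is the k-th (weak) derivative; du 0 .. du (m-1) are continuous on [0,L],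
  each is the indefinite integral of the next one, and du m is in L^2(0,L).\<close>
definition sobolev_H :: "real \<Rightarrow> nat \<Rightarrow> (nat \<Rightarrow> real \<Rightarrow> real) \<Rightarrow> bool" where
  "sobolev_H L m du \<longleftrightarrow>
     (\<forall>j<m. continuous_on {0..L} (du j) \<and>
        (\<forall>x\<in>{0..L}. (du (Suc j) has_integral (du j x - du j 0)) {0..x})) \<and>
     set_borel_measurable lborel {0..L} (du m) \<and>
     set_integrable lborel {0..L} (\<lambda>x. (du m x)\<^sup>2)"

definition L2_on :: "real \<Rightarrow> (real \<Rightarrow> real) \<Rightarrow> bool" where
  "L2_on L f \<longleftrightarrow> set_borel_measurable lborel {0..L} f \<and>
     set_integrable lborel {0..L} (\<lambda>x. (f x)\<^sup>2)"

definition L2_norm :: "real \<Rightarrow> (real \<Rightarrow> real) \<Rightarrow> real" where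
  "L2_norm L f = sqrt (set_lebesgue_integral lborel {0..L} (\<lambda>x. (f x)\<^sup>2))"

definition H_norm :: "real \<Rightarrow> nat \<Rightarrow> (nat \<Rightarrow> real \<Rightarrow> real) \<Rightarrow> real" where
  "H_norm L m du = sqrt (\<Sum>j\<le>m. (L2_norm L (du j))\<^sup>2)"

definition coeff_conditions :: "nat \<Rightarrow> (nat \<Rightarrow> nat \<Rightarrow> real) \<Rightarrow> (nat \<Rightarrow> nat \<Rightarrow> real) \<Rightarrow> bool" where
  "coeff_conditions l a b \<longleftrightarrow>
    (l = 2 \<longrightarrow> b 3 1 > 1/2 \<and> a 3 1 < 1/2) \<and>
    (l = 3 \<longrightarrow> b 5 1 < -1/2 \<and> b 4 2 > 1/2 \<and> a 5 1 > 1/2 \<and> a 4 2 < 1/2) \<and>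
    (l \<ge> 4 \<longrightarrow>
       b (l+1) (l-1) > real l - 2 \<and> b (l+2) (l-2) < 2 - real l \<and>
       a (l+1) (l-1) < 5 - 2 * real l \<and> a (l+2) (l-2) > 2 * real l - 5 \<and>
       (\<forall>j. odd j \<and> 3 \<le> j \<and> j \<le> l - 1 \<longrightarrow>
          b (l+j) (l-j) > real l - 2 +
             (1/2) * (\<Sum>m=1..(j-1) div 2. \<bar>b (l+2*m-1) (l-2*m+1)\<bar>)\<^sup>2 \<and>
          a (l+j) (l-j) < 5 - 2 * real l -
             (1/2) * (\<Sum>m=1..(j-1) div 2. \<bar>a (l+2*m-1) (l-2*m+1)\<bar>)\<^sup>2) \<and>
       (\<forall>j. even j \<and> 4 \<le> j \<and> j \<le> l - 1 \<longrightarrow>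
          b (l+j) (l-j) < 2 - real l -
             (1/2) * (\<Sum>m=1..j div 2 - 1. \<bar>b (l+2*m) (l-2*m)\<bar>)\<^sup>2 \<and>
          a (l+j) (l-j) > 2 * real l - 5 +
             (1/2) * (\<Sum>m=1..j div 2 - 1. \<bar>a (l+2*m) (l-2*m)\<bar>)\<^sup>2))"

definition is_solution :: "real \<Rightarrow> nat \<Rightarrow> real \<Rightarrow> (nat \<Rightarrow> nat \<Rightarrow> real) \<Rightarrow> (nat \<Rightarrow> nat \<Rightarrow> real)
     \<Rightarrow> (real \<Rightarrow> real) \<Rightarrow> (nat \<Rightarrow> real \<Rightarrow> real) \<Rightarrow> bool" where
  "is_solution L l lam a b f du \<longleftrightarrow>
     sobolev_H L (2*l+1) du \<and>
     (AE x in lborel. x \<in> {0<..<L} \<longrightarrow>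
        lam * du 0 x + (\<Sum>j=1..l. (-1)^(j+1) * du (2*j+1) x) = f x) \<and>
     du 0 0 = 0 \<and> du 0 L = 0 \<and> du l L = 0 \<and>
     (\<forall>j\<in>{1..l-1}. du (l+j) 0 = a (l+j) (l-j) * du (l-j) 0 \<and>
                    du (l+j) L = b (l+j) (l-j) * du (l-j) L)"

end

theory Submission
  imports Defs "Jordan_Normal_Form.Determinant"
begin

text \<open>
  Integrating \<open>u * (\<Sum>j. (-1)^(j+1) * D^(2j+1) u)\<close> by parts leaves only boundary terms, collected in a
  quadratic form in the jet of \<open>u\<close>. Under the boundary conditions the coefficient conditions make
  the diagonal of this form dominate the mixed terms, so that it is nonnegative at \<open>L\<close> and nonpositive
  at \<open>0\<close>. Along a solution of the homogeneous problem its derivative is \<open>-lam * u^2\<close>, hence it vanishes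
  identically and so does \<open>u\<close>.

  The problem consists of a linear equation of order \<open>2l+1\<close> and \<open>2l+1\<close> two-point conditions, so
  uniqueness gives existence: add to a particular solution with zero initial data the combination
  of a fundamental system that corrects the boundary values. The estimate follows because the particular
  solution is bounded by \<open>f\<close> and the correction depends linearly on its boundary values.
\<close>

section \<open>The boundary form\<close>

text \<open>The diagonal arises from one pairing: \<open>y k\<close> meets \<open>y (2*l-k)\<close>,
  and the boundary condition of index \<open>l-k\<close> turns the latter into a multiple of
  \<open>y k\<close>. Each coefficient thus weighs one square. It also enters mixed terms, since
  entries above order \<open>l\<close> are rewritten by the same conditions; this is the origin of
  the sums of earlier coefficients in the hypotheses. Mixed terms are split by Young's inequality,
  and for \<open>l >= 4\<close> the constants \<open>l-2\<close> and \<open>2*l-5\<close> dominate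
  the count of how often each square is charged. The ends differ because \<open>D^l u\<close>
  vanishes at \<open>L\<close> but is free at \<open>0\<close>, where its products must be absorbed
  by the term \<open>-(y l)^2/2\<close> of the form.

  The data are only square integrable, so the derivative of order \<open>2*l+1\<close> is determined
  only up to null sets. Hence existence starts from the equation integrated once, whose unknown is
  continuous, while for zero data the equation itself supplies a continuous top derivative, which
  justifies differentiating the form pointwise.\<close>

definition energy_form :: "nat \<Rightarrow> (nat \<Rightarrow> real) \<Rightarrow> real" where
  "energy_form l y =
     (\<Sum>j=1..l. (\<Sum>k<j. (-1)^(j+1+k) * y k * y (2*j-k)) - (y j)\<^sup>2 / 2)"

text \<open>Each \<open>j\<close> is settled separately. By the product rule the sum over
  \<open>k\<close> telescopes, leaving the wanted term and the middle product
  \<open>y j * y (Suc j)\<close>; the latter is an exact derivative, and \<open>-(y j)^2/2\<close>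
  is there to cancel it.\<close>

lemma energy_form_has_real_derivative:
  assumes "\<And>k. k \<le> 2*l \<Longrightarrow> (y k has_real_derivative y (Suc k) x) (at x within S)"
  shows "((\<lambda>t. energy_form l (\<lambda>k. y k t)) has_real_derivative
           y 0 x * (\<Sum>j=1..l. (-1)^(j+1) * y (2*j+1) x)) (at x within S)"
proof -
  have "((\<lambda>t. (\<Sum>k<j. (-1)^(j+1+k) * y k t * y (2*j-k) t) - (y j t)\<^sup>2 / 2)
          has_real_derivative y 0 x * ((-1)^(j+1) * y (2*j+1) x)) (at x within S)"
    if j: "j \<in> {1..l}" for j
  proof -
    define t where "t k = (-1::real)^(j+1+k) * y k x * y (2*j+1-k) x" for k
    have "((\<lambda>t. (-1)^(j+1+k) * y k t * y (2*j-k) t) has_real_derivative t k - t (Suc k))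
            (at x within S)" if "k < j" for k
    proof -
      have s: "Suc (2*j-k) = 2*j+1-k" using that by simp
      have a: "(y k has_real_derivative y (Suc k) x) (at x within S)"
        using j that by (intro assms) auto
      have b: "(y (2*j-k) has_real_derivative y (2*j+1-k) x) (at x within S)"
        using assms[of "2*j-k"] j that unfolding s by auto
      show ?thesis
        by (rule derivative_eq_intros a b refl | simp add: t_def algebra_simps)+
    qed
    then have 1: "((\<lambda>t. \<Sum>k<j. (-1)^(j+1+k) * y k t * y (2*j-k) t) has_real_derivative
        (\<Sum>k<j. t k - t (Suc k))) (at x within S)"
      by (intro DERIV_sum) auto
    have 2: "((\<lambda>t. (y j t)\<^sup>2 / 2) has_real_derivative y j x * y (Suc j) x) (at x within S)"
      using j by (auto intro!: derivative_eq_intros assms)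
    have "(\<Sum>k<j. t k - t (Suc k)) = t 0 - t j"
      by (rule sum_lessThan_telescope')
    also have "t j = - (y j x * y (Suc j) x)"
      by (simp add: t_def power_add[symmetric] mult_2[symmetric])
    finally have "(\<Sum>k<j. t k - t (Suc k)) - y j x * y (Suc j) x
        = y 0 x * ((-1)^(j+1) * y (2*j+1) x)"
      by (simp add: t_def)
    with DERIV_diff[OF 1 2] show ?thesis by simp
  qed
  then show ?thesis
    unfolding energy_form_def sum_distrib_left by (intro DERIV_sum) auto
qed

text \<open>Grouping by the lower index \<open>k\<close> puts \<open>y (2*l-k)\<close>, the entry
  that the boundary conditions turn into a multiple of \<open>y k\<close>, at the end
  \<open>i = l-k\<close> of row \<open>k\<close>.\<close>

lemma energy_form_rows:
  assumes "y 0 = 0"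
  shows "energy_form l y =
     (\<Sum>k=1..<l. y k * (\<Sum>i=1..l-k. (-1)^(i+1) * y (k+2*i))) - (\<Sum>j=1..l. (y j)\<^sup>2) / 2"
proof -
  have "(\<Sum>j=1..l. \<Sum>k<j. (-1)^(j+1+k) * y k * y (2*j-k))
      = (\<Sum>(j,k)\<in>(SIGMA j:{1..l}. {..<j}). (-1)^(j+1+k) * y k * y (2*j-k))"
    by (simp add: sum.Sigma)
  also have "\<dots> = (\<Sum>(k,i)\<in>(SIGMA k:{0..<l}. {1..l-k}). y k * ((-1)^(i+1) * y (k+2*i)))"
  proof (rule sum.reindex_bij_witness[where i="\<lambda>(k,i). (k+i,k)" and j="\<lambda>(j,k). (k,j-k)"])
    fix p assume "p \<in> (SIGMA j:{1..l}. {..<j})"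
    then obtain j k where p: "p = (j,k)" "k < j" "j \<le> l" by auto
    then have "(-1::real)^(j+1+k) = (-1)^(j-k+1)"
      by (simp add: minus_one_power_iff)
    with p show "(case (case p of (j,k) \<Rightarrow> (k,j-k)) of (k,i) \<Rightarrow> y k * ((-1)^(i+1) * y (k+2*i)))
        = (case p of (j,k) \<Rightarrow> (-1)^(j+1+k) * y k * y (2*j-k))"
      by (simp add: algebra_simps)
  qed auto
  also have "\<dots> = (\<Sum>k=0..<l. y k * (\<Sum>i=1..l-k. (-1)^(i+1) * y (k+2*i)))"
    by (simp add: sum.Sigma sum_distrib_left)
  also have "\<dots> = (\<Sum>k=1..<l. y k * (\<Sum>i=1..l-k. (-1)^(i+1) * y (k+2*i)))"
    by (cases l) (auto simp: sum.atLeast_Suc_lessThan assms)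
  finally show ?thesis
    unfolding energy_form_def sum_subtractf by (simp add: sum_divide_distrib)
qed

text \<open>The sum of \<open>|c m|\<close> over the \<open>m\<close> with \<open>1 <= m < n\<close>
  of the same parity as \<open>n\<close>, written with \<open>m = 2*i-n\<close> because
  \<open>i\<close> is then the position of the entry of index \<open>l+m\<close> in row
  \<open>l-n\<close>.\<close>

definition lower_sum :: "(nat \<Rightarrow> real) \<Rightarrow> nat \<Rightarrow> real" where
  "lower_sum c n = (\<Sum>i\<in>{i. i < n \<and> n < 2*i}. \<bar>c (2*i-n)\<bar>)"

lemma lower_sum_odd:
  assumes "odd n"
  shows "lower_sum c n = (\<Sum>m=1..(n-1) div 2. \<bar>c (2*m-1)\<bar>)"
proof -
  from assms obtain h where n: "n = 2*h+1" by (elim oddE)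
  show ?thesis unfolding lower_sum_def n
    by (rule sum.reindex_bij_witness[where i="\<lambda>m. h+m" and j="\<lambda>i. i-h"])
       (auto simp: algebra_simps intro!: arg_cong[where f=c])
qed

lemma lower_sum_even:
  assumes "even n"
  shows "lower_sum c n = (\<Sum>m=1..n div 2-1. \<bar>c (2*m)\<bar>)"
proof -
  from assms obtain h where n: "n = 2*h" by (elim evenE)
  show ?thesis unfolding lower_sum_def n
    by (rule sum.reindex_bij_witness[where i="\<lambda>m. h+m" and j="\<lambda>i. i-h"])
       (auto simp: algebra_simps intro!: arg_cong[where f=c])
qed

text \<open>The entries of row \<open>k\<close> before the last have index below, equal to or above
  \<open>l\<close>. Those above are folded back by \<open>bc\<close> to an index \<open>l-m\<close>,
  which is still at least \<open>k+2\<close> because the last entry is left out. Young's inequality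
  then charges \<open>W/2\<close> to each of the two outer groups. The product with
  \<open>y l\<close> stays as it is, since the two ends of the interval treat it
  differently.\<close>

lemma row_bound:
  assumes k: "1 \<le> k" "k < l"
    and bc: "\<And>m. 1 \<le> m \<Longrightarrow> m < l \<Longrightarrow> y (l+m) = c m * y (l-m)"
  shows "\<bar>y k * (\<Sum>i=1..<l-k. (-1)^(i+1) * y (k+2*i))\<bar>
     \<le> (real (l-2-k) + (lower_sum c (l-k))\<^sup>2) / 2 * (y k)\<^sup>2
        + (\<Sum>p=k+2..<l. (y p)\<^sup>2) + \<bar>y k\<bar> * \<bar>y l\<bar>"
proof -
  define W where "W = (\<Sum>p=k+2..<l. (y p)\<^sup>2)"
  have W0: "0 \<le> W" unfolding W_def by (intro sum_nonneg) auto
  let ?A = "{i\<in>{1..<l-k}. k+2*i < l}" and ?B = "{i\<in>{1..<l-k}. k+2*i = l}"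
    and ?C = "{i\<in>{1..<l-k}. l < k+2*i}"
  have un: "{1..<l-k} = ?A \<union> (?B \<union> ?C)" by auto
  have "\<bar>\<Sum>i=1..<l-k. (-1)^(i+1) * y (k+2*i)\<bar> \<le> (\<Sum>i=1..<l-k. \<bar>(-1)^(i+1) * y (k+2*i)\<bar>)"
    by (rule sum_abs)
  also have "\<dots> = (\<Sum>i=1..<l-k. \<bar>y (k+2*i)\<bar>)"
    by (simp add: abs_mult)
  also have "\<dots> = (\<Sum>i\<in>?A. \<bar>y (k+2*i)\<bar>) + ((\<Sum>i\<in>?B. \<bar>y (k+2*i)\<bar>) + (\<Sum>i\<in>?C. \<bar>y (k+2*i)\<bar>))"
    by (subst un) (subst sum.union_disjoint, auto)+
  finally have tri: "\<bar>y k * (\<Sum>i=1..<l-k. (-1)^(i+1) * y (k+2*i))\<bar>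
     \<le> \<bar>y k\<bar> * (\<Sum>i\<in>?A. \<bar>y (k+2*i)\<bar>) + \<bar>y k\<bar> * (\<Sum>i\<in>?B. \<bar>y (k+2*i)\<bar>)
        + \<bar>y k\<bar> * (\<Sum>i\<in>?C. \<bar>y (k+2*i)\<bar>)"
    unfolding abs_mult distrib_left[symmetric] add.assoc by (intro mult_left_mono) auto
  have "\<bar>y k\<bar> * (\<Sum>i\<in>?A. \<bar>y (k+2*i)\<bar>) = (\<Sum>p\<in>(\<lambda>i. k+2*i) ` ?A. \<bar>y k\<bar> * \<bar>y p\<bar>)"
    by (subst sum.reindex) (auto simp: inj_on_def sum_distrib_left)
  \<comment> \<open>The row meets only every second index; admitting all of them gives the same
    \<open>W\<close> as in the third group.\<close>
  also have "\<dots> \<le> (\<Sum>p=k+2..<l. \<bar>y k\<bar> * \<bar>y p\<bar>)"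
    by (intro sum_mono2) auto
  also have "\<dots> \<le> (\<Sum>p=k+2..<l. ((y k)\<^sup>2 + (y p)\<^sup>2) / 2)"
  proof (intro sum_mono)
    fix p
    show "\<bar>y k\<bar> * \<bar>y p\<bar> \<le> ((y k)\<^sup>2 + (y p)\<^sup>2) / 2"
      using sum_squares_bound[of "\<bar>y k\<bar>" "\<bar>y p\<bar>"] by simp
  qed
  also have "\<dots> = real (l-2-k) / 2 * (y k)\<^sup>2 + W / 2"
    by (simp add: W_def sum.distrib sum_divide_distrib add_divide_distrib)
  finally have A: "\<bar>y k\<bar> * (\<Sum>i\<in>?A. \<bar>y (k+2*i)\<bar>) \<le> real (l-2-k) / 2 * (y k)\<^sup>2 + W / 2" .
  have "?B \<subseteq> {(l-k) div 2}" by auto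
  then have card: "card ?B \<le> 1"
    using card_mono[of "{(l-k) div 2}" ?B] by simp
  have "(\<Sum>i\<in>?B. \<bar>y (k+2*i)\<bar>) = real (card ?B) * \<bar>y l\<bar>"
    by simp
  also have "\<dots> \<le> 1 * \<bar>y l\<bar>"
    using card by (intro mult_right_mono) auto
  finally have "(\<Sum>i\<in>?B. \<bar>y (k+2*i)\<bar>) \<le> \<bar>y l\<bar>" by simp
  then have B: "\<bar>y k\<bar> * (\<Sum>i\<in>?B. \<bar>y (k+2*i)\<bar>) \<le> \<bar>y k\<bar> * \<bar>y l\<bar>"
    by (intro mult_left_mono) auto
  have "(\<Sum>i\<in>?C. \<bar>y (k+2*i)\<bar>) \<le> (\<Sum>i\<in>?C. \<bar>c (2*i-(l-k))\<bar> * sqrt W)"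
  proof (intro sum_mono)
    fix i assume i: "i \<in> ?C"
    define m where "m = 2*i-(l-k)"
    have m: "1 \<le> m" "m < l" "k+2*i = l+m" "k+2 \<le> l-m" "l-m < l"
      using i k unfolding m_def by auto
    \<comment> \<open>Bounding every single entry by the same \<open>sqrt W\<close> lets the
      coefficients add up before they are squared, which produces the squared sums of the
      coefficient conditions.\<close>
    have "(y (l-m))\<^sup>2 \<le> W"
      unfolding W_def using m by (intro member_le_sum) auto
    then have "\<bar>y (l-m)\<bar> \<le> sqrt W"
      by (simp add: real_le_rsqrt)
    then show "\<bar>y (k+2*i)\<bar> \<le> \<bar>c (2*i-(l-k))\<bar> * sqrt W"
      unfolding m(3) bc[OF m(1,2)] m_def[symmetric] abs_mult by (intro mult_left_mono) auto
  qed
  also have "\<dots> = lower_sum c (l-k) * sqrt W"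
    unfolding lower_sum_def sum_distrib_right by (intro sum.cong) auto
  finally have "\<bar>y k\<bar> * (\<Sum>i\<in>?C. \<bar>y (k+2*i)\<bar>) \<le> \<bar>y k\<bar> * (lower_sum c (l-k) * sqrt W)"
    by (intro mult_left_mono) auto
  also have "\<dots> \<le> ((lower_sum c (l-k) * \<bar>y k\<bar>)\<^sup>2 + (sqrt W)\<^sup>2) / 2"
    using sum_squares_bound[of "lower_sum c (l-k) * \<bar>y k\<bar>" "sqrt W"] by (simp add: mult_ac)
  also have "\<dots> = (lower_sum c (l-k))\<^sup>2 / 2 * (y k)\<^sup>2 + W / 2"
    using W0 by (simp add: power_mult_distrib)
  finally have C: "\<bar>y k\<bar> * (\<Sum>i\<in>?C. \<bar>y (k+2*i)\<bar>) \<le> (lower_sum c (l-k))\<^sup>2 / 2 * (y k)\<^sup>2 + W / 2" .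
  show ?thesis
    using tri A B C unfolding W_def[symmetric] by (simp add: field_simps)
qed

text \<open>Summing \<open>row_bound\<close> over the rows charges the square of \<open>y p\<close>
  once for each row \<open>k <= p-2\<close>, hence the weight \<open>real (p-2)\<close>. Truncated
  subtraction is right at both extremes: no row charges \<open>y 1\<close>, and row
  \<open>l-1\<close> has no entries to split.\<close>

lemma energy_form_bound:
  assumes y0: "y 0 = 0"
    and bc: "\<And>m. 1 \<le> m \<Longrightarrow> m < l \<Longrightarrow> y (l+m) = c m * y (l-m)"
  shows "\<bar>energy_form l y + (\<Sum>j=1..l. (y j)\<^sup>2) / 2
            - (\<Sum>k=1..<l. (-1)^(l-k+1) * c (l-k) * (y k)\<^sup>2)\<bar>
     \<le> (\<Sum>k=1..<l. ((real (l-2-k) + (lower_sum c (l-k))\<^sup>2) / 2 + real (k-2)) * (y k)\<^sup>2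
          + \<bar>y k\<bar> * \<bar>y l\<bar>)"
proof -
  have row: "y k * (\<Sum>i=1..l-k. (-1)^(i+1) * y (k+2*i))
      = y k * (\<Sum>i=1..<l-k. (-1)^(i+1) * y (k+2*i)) + (-1)^(l-k+1) * c (l-k) * (y k)\<^sup>2"
    if "k \<in> {1..<l}" for k
  proof -
    have "{1..l-k} = insert (l-k) {1..<l-k}" using that by auto
    moreover have "y (k+2*(l-k)) = c (l-k) * y k"
      using bc[of "l-k"] that by (auto simp: algebra_simps simp flip: mult_2_right)
    ultimately show ?thesis by (simp add: algebra_simps power2_eq_square)
  qed
  have "energy_form l y + (\<Sum>j=1..l. (y j)\<^sup>2) / 2
            - (\<Sum>k=1..<l. (-1)^(l-k+1) * c (l-k) * (y k)\<^sup>2)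
      = (\<Sum>k=1..<l. y k * (\<Sum>i=1..<l-k. (-1)^(i+1) * y (k+2*i)))"
    unfolding energy_form_rows[of y, OF y0] using row by (simp add: sum.distrib del: power_Suc)
  also have "\<bar>\<dots>\<bar> \<le> (\<Sum>k=1..<l. \<bar>y k * (\<Sum>i=1..<l-k. (-1)^(i+1) * y (k+2*i))\<bar>)"
    by (rule sum_abs)
  also have "\<dots> \<le> (\<Sum>k=1..<l. (real (l-2-k) + (lower_sum c (l-k))\<^sup>2) / 2 * (y k)\<^sup>2
        + (\<Sum>p=k+2..<l. (y p)\<^sup>2) + \<bar>y k\<bar> * \<bar>y l\<bar>)"
    using bc by (intro sum_mono row_bound) auto
  also have "\<dots> = (\<Sum>k=1..<l. (real (l-2-k) + (lower_sum c (l-k))\<^sup>2) / 2 * (y k)\<^sup>2)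
        + (\<Sum>k=1..<l. \<Sum>p=k+2..<l. (y p)\<^sup>2) + (\<Sum>k=1..<l. \<bar>y k\<bar> * \<bar>y l\<bar>)"
    by (simp add: sum.distrib)
  also have "(\<Sum>k=1..<l. \<Sum>p=k+2..<l. (y p)\<^sup>2) = (\<Sum>k=1..<l. \<Sum>p | p \<in> {1..<l} \<and> k+2 \<le> p. (y p)\<^sup>2)"
    by (intro sum.cong) auto
  also have "\<dots> = (\<Sum>p=1..<l. \<Sum>k | k \<in> {1..<l} \<and> k+2 \<le> p. (y p)\<^sup>2)"
    by (rule sum.swap_restrict) auto
  also have "\<dots> = (\<Sum>p=1..<l. real (p-2) * (y p)\<^sup>2)"
  proof (intro sum.cong refl)
    fix p assume "p \<in> {1..<l}"
    then have "{k. k \<in> {1..<l} \<and> k+2 \<le> p} = {1..p-2}" by auto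
    then show "(\<Sum>k | k \<in> {1..<l} \<and> k+2 \<le> p. (y p)\<^sup>2) = real (p-2) * (y p)\<^sup>2"
      by simp
  qed
  finally show ?thesis
    by (simp add: sum.distrib distrib_right)
qed

text \<open>With \<open>y l = 0\<close> the products left over by \<open>row_bound\<close>
  disappear. Apart from the part with \<open>lower_sum\<close>, the charge on
  \<open>(y k)^2\<close>, including the \<open>1/2\<close> from the form itself, is largest at
  \<open>k = l-1\<close>, where it is \<open>l - 5/2\<close>; this stays below the available
  \<open>l-2\<close>.\<close>

lemma energy_form_nonneg:
  assumes l: "l \<ge> 3" and y0: "y 0 = 0" and yl: "y l = 0"
    and bc: "\<And>m. 1 \<le> m \<Longrightarrow> m < l \<Longrightarrow> y (l+m) = c m * y (l-m)"
    and c: "\<And>m. 1 \<le> m \<Longrightarrow> m < l \<Longrightarrow>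
        real l - 2 + (lower_sum c m)\<^sup>2 / 2 \<le> (-1)^(m+1) * c m"
  shows "0 \<le> energy_form l y"
proof -
  have "(\<Sum>k=1..<l. (-1)^(l-k+1) * c (l-k) * (y k)\<^sup>2)
     - (\<Sum>k=1..<l. ((real (l-2-k) + (lower_sum c (l-k))\<^sup>2) / 2 + real (k-2)) * (y k)\<^sup>2
          + \<bar>y k\<bar> * \<bar>y l\<bar>) - (\<Sum>j=1..l. (y j)\<^sup>2) / 2 \<le> energy_form l y"
    using energy_form_bound[of y l c, OF y0 bc] unfolding abs_le_iff by linarith
  moreover have "{1..l} = insert l {1..<l}" using l by auto
  then have "(\<Sum>j=1..l. (y j)\<^sup>2) / 2 = (\<Sum>j=1..<l. (y j)\<^sup>2 / 2)"
    by (simp add: yl sum_divide_distrib)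
  moreover have "0 \<le> (\<Sum>k=1..<l. (-1)^(l-k+1) * c (l-k) * (y k)\<^sup>2
     - (((real (l-2-k) + (lower_sum c (l-k))\<^sup>2) / 2 + real (k-2)) * (y k)\<^sup>2 + \<bar>y k\<bar> * \<bar>y l\<bar>)
     - (y k)\<^sup>2 / 2)"
  proof (intro sum_nonneg)
    fix k assume k: "k \<in> {1..<l}"
    have "real (l-2-k) / 2 + real (k-2) + 1/2 \<le> real l - 2"
      using k l by (auto simp: field_simps)
    moreover have "real l - 2 + (lower_sum c (l-k))\<^sup>2 / 2 \<le> (-1)^(l-k+1) * c (l-k)"
      using k by (intro c) auto
    ultimately have "0 \<le> (-1)^(l-k+1) * c (l-k)
       - ((real (l-2-k) + (lower_sum c (l-k))\<^sup>2) / 2 + real (k-2)) - 1/2"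
      unfolding add_divide_distrib by linarith
    from mult_nonneg_nonneg[OF this zero_le_power2[of "y k"]]
    show "0 \<le> (-1)^(l-k+1) * c (l-k) * (y k)\<^sup>2
     - (((real (l-2-k) + (lower_sum c (l-k))\<^sup>2) / 2 + real (k-2)) * (y k)\<^sup>2 + \<bar>y k\<bar> * \<bar>y l\<bar>)
     - (y k)\<^sup>2 / 2"
      by (simp add: yl left_diff_distrib)
  qed
  ultimately show ?thesis by (simp add: sum_subtractf)
qed

text \<open>Here \<open>y l\<close> is free, and the only term that can absorb its products with the
  other entries is \<open>-(y l)^2/2\<close>. The price is an extra \<open>(l-1)/2\<close> on every
  diagonal coefficient, which explains why the condition is stronger than at the other end.\<close>

lemma energy_form_nonpos:
  assumes l: "l \<ge> 3" and y0: "y 0 = 0"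
    and bc: "\<And>m. 1 \<le> m \<Longrightarrow> m < l \<Longrightarrow> y (l+m) = c m * y (l-m)"
    and c: "\<And>m. 1 \<le> m \<Longrightarrow> m < l \<Longrightarrow>
        (-1)^(m+1) * c m \<le> 5 - 2 * real l - (lower_sum c m)\<^sup>2 / 2"
  shows "energy_form l y \<le> 0"
proof -
  have "energy_form l y \<le> (\<Sum>k=1..<l. (-1)^(l-k+1) * c (l-k) * (y k)\<^sup>2)
     + (\<Sum>k=1..<l. ((real (l-2-k) + (lower_sum c (l-k))\<^sup>2) / 2 + real (k-2)) * (y k)\<^sup>2
          + \<bar>y k\<bar> * \<bar>y l\<bar>) - (\<Sum>j=1..l. (y j)\<^sup>2) / 2"
    using energy_form_bound[of y l c, OF y0 bc] unfolding abs_le_iff by linarith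
  moreover have "{1..l} = insert l {1..<l}" using l by auto
  then have "(\<Sum>j=1..l. (y j)\<^sup>2) / 2 = (\<Sum>j=1..<l. (y j)\<^sup>2 / 2) + (y l)\<^sup>2 / 2"
    by (simp add: sum_divide_distrib add_divide_distrib)
  \<comment> \<open>The square is shared equally among the \<open>l-1\<close> rows; this share
    dictates the weight \<open>l-1\<close> used in Young's inequality below.\<close>
  moreover have "(y l)\<^sup>2 / 2 \<ge> (\<Sum>k=1..<l. (y l)\<^sup>2 / (2 * (real l - 1)))"
    using l by (simp add: field_simps)
  moreover have "(\<Sum>k=1..<l. (-1)^(l-k+1) * c (l-k) * (y k)\<^sup>2
     + (((real (l-2-k) + (lower_sum c (l-k))\<^sup>2) / 2 + real (k-2)) * (y k)\<^sup>2 + \<bar>y k\<bar> * \<bar>y l\<bar>)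
     - (y k)\<^sup>2 / 2 - (y l)\<^sup>2 / (2 * (real l - 1))) \<le> 0"
  proof (intro sum_nonpos)
    fix k assume k: "k \<in> {1..<l}"
    have "real (l-2-k) / 2 + real (k-2) + (real l - 1) / 2 - 1/2 \<le> 2 * real l - 5"
      using k l by (auto simp: field_simps)
    moreover have "(-1)^(l-k+1) * c (l-k) \<le> 5 - 2 * real l - (lower_sum c (l-k))\<^sup>2 / 2"
      using k by (intro c) auto
    ultimately have "(-1)^(l-k+1) * c (l-k)
       + ((real (l-2-k) + (lower_sum c (l-k))\<^sup>2) / 2 + real (k-2)) + (real l - 1) / 2 - 1/2 \<le> 0"
      unfolding add_divide_distrib by linarith
    from mult_nonpos_nonneg[OF this zero_le_power2[of "y k"]]
    have "(-1)^(l-k+1) * c (l-k) * (y k)\<^sup>2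
       + ((real (l-2-k) + (lower_sum c (l-k))\<^sup>2) / 2 + real (k-2)) * (y k)\<^sup>2
       + (real l - 1) / 2 * (y k)\<^sup>2 - (y k)\<^sup>2 / 2 \<le> 0"
      by (simp only: left_diff_distrib distrib_right mult.assoc)
    moreover have "\<bar>y k\<bar> * \<bar>y l\<bar> \<le> (real l - 1) / 2 * (y k)\<^sup>2 + (y l)\<^sup>2 / (2 * (real l - 1))"
    proof -
      define r where "r = real l - 1"
      have r: "r > 0" using l by (simp add: r_def)
      have "2 * (r * \<bar>y k\<bar>) * \<bar>y l\<bar> \<le> (r * \<bar>y k\<bar>)\<^sup>2 + \<bar>y l\<bar>\<^sup>2"
        by (rule sum_squares_bound)
      then show ?thesis using r unfolding r_def[symmetric]
        by (simp add: field_simps power2_eq_square)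
    qed
    ultimately show "(-1)^(l-k+1) * c (l-k) * (y k)\<^sup>2
     + (((real (l-2-k) + (lower_sum c (l-k))\<^sup>2) / 2 + real (k-2)) * (y k)\<^sup>2 + \<bar>y k\<bar> * \<bar>y l\<bar>)
     - (y k)\<^sup>2 / 2 - (y l)\<^sup>2 / (2 * (real l - 1)) \<le> 0" by linarith
  qed
  ultimately show ?thesis unfolding sum_subtractf sum.distrib by linarith
qed

text \<open>The factor \<open>(-1)^(m+1)\<close> merges the conditions for odd and even indices into
  one, and the separate conditions for \<open>m = 1\<close> and \<open>m = 2\<close> are the
  instances in which \<open>lower_sum\<close> is empty.\<close>

lemma coeff_conditions_lower_sum:
  assumes l: "l \<ge> 4" and cc: "coeff_conditions l a b" and m: "1 \<le> m" "m < l"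
  shows "real l - 2 + (lower_sum (\<lambda>m. b (l+m) (l-m)) m)\<^sup>2 / 2 \<le> (-1)^(m+1) * b (l+m) (l-m)"
    and "(-1)^(m+1) * a (l+m) (l-m) \<le> 5 - 2 * real l - (lower_sum (\<lambda>m. a (l+m) (l-m)) m)\<^sup>2 / 2"
proof -
  have odd_eq: "lower_sum (\<lambda>m. d (l+m) (l-m)) m = (\<Sum>i=1..(m-1) div 2. \<bar>d (l+2*i-1) (l-2*i+1)\<bar>)"
    if "odd m" for d :: "nat \<Rightarrow> nat \<Rightarrow> real"
    unfolding lower_sum_odd[OF that]
  proof (intro sum.cong refl)
    fix i assume "i \<in> {1..(m-1) div 2}"
    \<comment> \<open>The subtractions are on naturals and remain exact because
      \<open>1 <= i\<close> and \<open>2*i <= m-1 < l\<close>.\<close>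
    then have "l + (2*i-1) = l+2*i-1" "l - (2*i-1) = l-2*i+1" using m by auto
    then show "\<bar>d (l + (2*i-1)) (l - (2*i-1))\<bar> = \<bar>d (l+2*i-1) (l-2*i+1)\<bar>" by simp
  qed
  note c4 = cc[unfolded coeff_conditions_def, THEN conjunct2, THEN conjunct2, rule_format, OF l]
  have "m = 1 \<or> m = 2 \<or> odd m \<and> m \<ge> 3 \<or> even m \<and> m \<ge> 4"
    using m(1) by presburger
  then consider "m = 1" | "m = 2" | "odd m" "m \<ge> 3" | "even m" "m \<ge> 4"
    by blast
  then have "real l - 2 + (lower_sum (\<lambda>m. b (l+m) (l-m)) m)\<^sup>2 / 2 \<le> (-1)^(m+1) * b (l+m) (l-m)
    \<and> (-1)^(m+1) * a (l+m) (l-m) \<le> 5 - 2 * real l - (lower_sum (\<lambda>m. a (l+m) (l-m)) m)\<^sup>2 / 2"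
  proof cases
    case 1
    then show ?thesis using c4 by (simp add: lower_sum_odd)
  next
    case 2
    then show ?thesis using c4 by (simp add: lower_sum_even)
  next
    case 3
    then show ?thesis using c4 m l unfolding odd_eq[OF 3(1)] by (auto intro: less_imp_le)
  next
    case 4
    have "b (l+m) (l-m) < 2 - real l - (1/2) * (\<Sum>i=1..m div 2 - 1. \<bar>b (l+2*i) (l-2*i)\<bar>)\<^sup>2"
     "a (l+m) (l-m) > 2 * real l - 5 + (1/2) * (\<Sum>i=1..m div 2 - 1. \<bar>a (l+2*i) (l-2*i)\<bar>)\<^sup>2"
      using c4 4 m l by auto
    then show ?thesis using 4 unfolding lower_sum_even[OF 4(1)] by auto
  qed
  then show "real l - 2 + (lower_sum (\<lambda>m. b (l+m) (l-m)) m)\<^sup>2 / 2 \<le> (-1)^(m+1) * b (l+m) (l-m)"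
    and "(-1)^(m+1) * a (l+m) (l-m) \<le> 5 - 2 * real l - (lower_sum (\<lambda>m. a (l+m) (l-m)) m)\<^sup>2 / 2"
    by auto
qed

section \<open>Sign of the boundary form at the two end points\<close>

lemma small_intervals:
  "{Suc 0..<2} = {1}" "{Suc 0..<3} = {1,2}" "{Suc 0..2} = {1,2}" "{Suc 0..3} = {1,2,3}"
  by auto

text \<open>The threshold \<open>1/2\<close> for \<open>l = 3\<close> is out of reach of
  \<open>energy_form_nonneg\<close>, which would ask for \<open>1\<close>. For \<open>l = 2\<close>
  and \<open>l = 3\<close> the form is therefore computed exactly; it is diagonal, since the only
  mixed product, \<open>y 1 * y 3\<close> for \<open>l = 3\<close>, contains
  \<open>y l = 0\<close>.\<close>

lemma energy_form_right_end:
  assumes l: "l \<ge> 2" and cc: "coeff_conditions l a b" and y0: "y 0 = 0" and yl: "y l = 0"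
    and bc: "\<And>m. 1 \<le> m \<Longrightarrow> m < l \<Longrightarrow> y (l+m) = b (l+m) (l-m) * y (l-m)"
  shows "0 \<le> energy_form l y"
proof -
  consider "l = 2" | "l = 3" | "l \<ge> 4" using l by linarith
  then show ?thesis
  proof cases
    case 1
    have "energy_form l y = (b 3 1 - 1/2) * (y 1)\<^sup>2"
      using yl bc[of 1] unfolding energy_form_rows[of y, OF y0] 1
      by (simp add: numeral_3_eq_3 small_intervals power2_eq_square field_simps)
    then show ?thesis using cc 1 by (simp add: coeff_conditions_def)
  next
    case 2
    have "energy_form l y = (- b 5 1 - 1/2) * (y 1)\<^sup>2 + (b 4 2 - 1/2) * (y 2)\<^sup>2"
      using yl bc[of 1] bc[of 2] unfolding energy_form_rows[of y, OF y0] 2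
      by (simp add: numeral_3_eq_3[symmetric] small_intervals power2_eq_square field_simps)
    then show ?thesis using cc 2 by (simp add: coeff_conditions_def)
  next
    case 3
    show ?thesis
      using 3 bc coeff_conditions_lower_sum(1)[OF 3 cc]
      by (intro energy_form_nonneg[where c="\<lambda>m. b (l+m) (l-m)"] y0 yl) auto
  qed
qed

lemma energy_form_left_end:
  assumes l: "l \<ge> 2" and cc: "coeff_conditions l a b" and y0: "y 0 = 0"
    and bc: "\<And>m. 1 \<le> m \<Longrightarrow> m < l \<Longrightarrow> y (l+m) = a (l+m) (l-m) * y (l-m)"
  shows "energy_form l y \<le> 0"
proof -
  consider "l = 2" | "l = 3" | "l \<ge> 4" using l by linarith
  then show ?thesis
  proof cases
    case 1
    have "energy_form l y = (a 3 1 - 1/2) * (y 1)\<^sup>2 - (y 2)\<^sup>2 / 2"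
      using bc[of 1] unfolding energy_form_rows[of y, OF y0] 1
      by (simp add: numeral_3_eq_3 small_intervals power2_eq_square field_simps)
    moreover have "(a 3 1 - 1/2) * (y 1)\<^sup>2 \<le> 0"
      using cc 1 by (intro mult_nonpos_nonneg) (auto simp: coeff_conditions_def)
    ultimately show ?thesis by (smt (verit) zero_le_power2 divide_nonneg_pos)
  next
    case 2
    \<comment> \<open>Now \<open>y 3\<close> is free, but the mixed product \<open>y 1 * y 3\<close>
      completes the squares \<open>-(y 1)^2/2\<close> and \<open>-(y 3)^2/2\<close>.\<close>
    have "energy_form l y = - (a 5 1) * (y 1)\<^sup>2 + (a 4 2 - 1/2) * (y 2)\<^sup>2 - (y 1 - y 3)\<^sup>2 / 2"
      using bc[of 1] bc[of 2] unfolding energy_form_rows[of y, OF y0] 2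
      by (simp add: numeral_3_eq_3[symmetric] small_intervals power2_eq_square field_simps)
    moreover have "(a 4 2 - 1/2) * (y 2)\<^sup>2 \<le> 0" "- (a 5 1) * (y 1)\<^sup>2 \<le> 0"
      using cc 2 by (auto intro!: mult_nonpos_nonneg simp: coeff_conditions_def)
    ultimately show ?thesis by (smt (verit) zero_le_power2 divide_nonneg_pos)
  next
    case 3
    show ?thesis
      using 3 bc coeff_conditions_lower_sum(2)[OF 3 cc]
      by (intro energy_form_nonpos[where c="\<lambda>m. a (l+m) (l-m)"] y0) auto
  qed
qed

section \<open>Linear initial value problems with square integrable data\<close>

lemma L2_on_set_integrable:
  assumes "L2_on L f"
  shows "set_integrable lborel {0..L} f"
proof -
  have "set_integrable lborel {0..L} (\<lambda>x. 1 + (f x)\<^sup>2)"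
    using assms borel_integrable_atLeastAtMost'[of 0 L "\<lambda>_. 1 :: real"] unfolding L2_on_def
    by (intro set_integral_add) auto
  then show ?thesis
  proof (rule set_integrable_bound)
    show "set_borel_measurable lborel {0..L} f" using assms by (simp add: L2_on_def)
    have "\<bar>t\<bar> \<le> 1 + t\<^sup>2" for t :: real
    proof -
      have "0 \<le> (\<bar>t\<bar> - 1/2)\<^sup>2" by simp
      then show ?thesis by (simp add: power2_diff power_divide)
    qed
    then show "AE x in lborel. x \<in> {0..L} \<longrightarrow> norm (f x) \<le> norm (1 + (f x)\<^sup>2)"
      by (intro always_eventually) (auto simp: abs_of_nonneg add_nonneg_nonneg)
  qed
qed

lemma L2_on_integrable_on:
  assumes "L2_on L f" "x \<le> L"
  shows "f integrable_on {0..x}"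
proof -
  have "f integrable_on {0..L}"
    using L2_on_set_integrable[OF assms(1)] by (rule set_borel_integral_eq_integral(1))
  then show ?thesis by (rule integrable_subinterval_real) (use assms(2) in auto)
qed

lemma L2_on_linear_combination:
  assumes "L2_on L f" "L2_on L g"
  shows "L2_on L (\<lambda>x. r * f x + s * g x)"
proof -
  have m: "set_borel_measurable lborel {0..L} (\<lambda>x. r * f x + s * g x)"
    using assms unfolding L2_on_def set_borel_measurable_def
    by (auto simp: algebra_simps intro!: borel_measurable_add
        dest: borel_measurable_times[OF borel_measurable_const])
  have "set_integrable lborel {0..L} (\<lambda>x. 2 * (r\<^sup>2 * (f x)\<^sup>2) + 2 * (s\<^sup>2 * (g x)\<^sup>2))"
    using assms unfolding L2_on_def
    by (intro set_integral_add set_integrable_mult_right) auto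
  then have "set_integrable lborel {0..L} (\<lambda>x. (r * f x + s * g x)\<^sup>2)"
  proof (rule set_integrable_bound)
    have "(\<lambda>x. (indicator {0..L} x *\<^sub>R (r * f x + s * g x))\<^sup>2)
        = (\<lambda>x. indicator {0..L} x *\<^sub>R (r * f x + s * g x)\<^sup>2)"
      by (auto simp: fun_eq_iff indicator_def)
    then show "set_borel_measurable lborel {0..L} (\<lambda>x. (r * f x + s * g x)\<^sup>2)"
      using borel_measurable_power[OF m[unfolded set_borel_measurable_def], of 2]
      unfolding set_borel_measurable_def by simp
    have "(a + b)\<^sup>2 \<le> 2 * a\<^sup>2 + 2 * b\<^sup>2" for a b :: real
      using zero_le_power2[of "a - b"] by (simp add: power2_diff power2_sum)
    from this[of "r * f x" "s * g x" for x]
    show "AE x in lborel. x \<in> {0..L} \<longrightarrow> norm ((r * f x + s * g x)\<^sup>2)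
        \<le> norm (2 * (r\<^sup>2 * (f x)\<^sup>2) + 2 * (s\<^sup>2 * (g x)\<^sup>2))"
      by (intro always_eventually) (auto simp: abs_of_nonneg power_mult_distrib)
  qed
  with m show ?thesis by (simp add: L2_on_def)
qed

lemma continuous_on_imp_L2_on:
  assumes "continuous_on {0..L} f"
  shows "L2_on L f"
  unfolding L2_on_def
proof
  show "set_borel_measurable lborel {0..L} f"
    using borel_integrable_atLeastAtMost'[OF assms]
    by (simp add: set_integrable_def set_borel_measurable_def)
  show "set_integrable lborel {0..L} (\<lambda>x. (f x)\<^sup>2)"
    using assms by (intro borel_integrable_atLeastAtMost' continuous_intros)
qed

lemma L2_norm_nonneg: "0 \<le> L2_norm L f"
  unfolding L2_norm_def set_lebesgue_integral_def by (auto intro!: integral_nonneg_AE)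

lemma L2_norm_square:
  "(L2_norm L f)\<^sup>2 = set_lebesgue_integral lborel {0..L} (\<lambda>x. (f x)\<^sup>2)"
  unfolding L2_norm_def set_lebesgue_integral_def by (simp add: integral_nonneg_AE)

text \<open>Used with \<open>g\<close> the right-hand side to read off the top derivative from the
  equation, and with \<open>g = 0\<close> to turn uniform bounds on lower derivatives into norm
  bounds.\<close>

lemma L2_norm_square_le:
  assumes L: "L \<ge> 0" and h: "L2_on L h" and g: "L2_on L g"
    and le: "AE x in lborel. x \<in> {0..L} \<longrightarrow> \<bar>h x\<bar> \<le> \<bar>g x\<bar> + A" and A: "A \<ge> 0"
  shows "(L2_norm L h)\<^sup>2 \<le> 2 * (L2_norm L g)\<^sup>2 + 2 * A\<^sup>2 * L"
proof -
  have i: "set_integrable lborel {0..L} (\<lambda>x. 2 * (g x)\<^sup>2)" "set_integrable lborel {0..L} (\<lambda>x. 2 * A\<^sup>2)"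
    using g unfolding L2_on_def
    by (auto intro!: borel_integrable_atLeastAtMost' set_integrable_mult_right)
  have "(L2_norm L h)\<^sup>2 \<le> set_lebesgue_integral lborel {0..L} (\<lambda>x. 2 * (g x)\<^sup>2 + 2 * A\<^sup>2)"
    unfolding L2_norm_square
  proof (rule set_integral_mono_AE)
    show "set_integrable lborel {0..L} (\<lambda>x. (h x)\<^sup>2)" using h by (simp add: L2_on_def)
    show "set_integrable lborel {0..L} (\<lambda>x. 2 * (g x)\<^sup>2 + 2 * A\<^sup>2)"
      using i by (rule set_integral_add)
    show "AE x \<in> {0..L} in lborel. (h x)\<^sup>2 \<le> 2 * (g x)\<^sup>2 + 2 * A\<^sup>2"
      using le
    proof eventually_elim
      case (elim x)
      show ?case
      proof
        assume "x \<in> {0..L}"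
        then have "(h x)\<^sup>2 \<le> (\<bar>g x\<bar> + A)\<^sup>2"
          using elim by (metis abs_ge_zero power2_abs power_mono)
        also have "\<dots> \<le> 2 * (g x)\<^sup>2 + 2 * A\<^sup>2"
          using zero_le_power2[of "\<bar>g x\<bar> - A"] by (simp add: power2_diff power2_sum)
        finally show "(h x)\<^sup>2 \<le> 2 * (g x)\<^sup>2 + 2 * A\<^sup>2" .
      qed
    qed
  qed
  also have "\<dots> = 2 * (L2_norm L g)\<^sup>2 + 2 * A\<^sup>2 * L"
    using set_borel_integral_eq_integral(2)[OF i(2)] L
    unfolding L2_norm_square set_integral_add(2)[OF i] by simp
  finally show ?thesis .
qed

text \<open>Young's inequality with a parameter \<open>e\<close>, applied under the integral, takes
  the place of Cauchy-Schwarz. The choice \<open>e = 1/N\<close> gives \<open>(1+L)/2\<close>, an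
  upper bound for the sharp constant \<open>sqrt L\<close>; for \<open>N = 0\<close> the parameter
  is sent to infinity.\<close>

lemma integral_le_L2_norm:
  assumes L: "L \<ge> 0" and g: "L2_on L g" and x: "x \<in> {0..L}"
  shows "\<bar>integral {0..x} g\<bar> \<le> (1 + L) / 2 * L2_norm L g"
proof -
  define N where "N = L2_norm L g"
  have N0: "N \<ge> 0" by (simp add: N_def L2_norm_nonneg)
  have key: "\<bar>integral {0..x} g\<bar> \<le> (e * N\<^sup>2 + L / e) / 2" if e: "e > 0" for e
  proof -
    have i2: "(\<lambda>x. (g x)\<^sup>2) integrable_on {0..L}" "integral {0..L} (\<lambda>x. (g x)\<^sup>2) = N\<^sup>2"
      using g set_borel_integral_eq_integral[of "{0..L}" "\<lambda>x. (g x)\<^sup>2"]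
      by (auto simp: L2_on_def N_def L2_norm_square)
    have ih: "(\<lambda>t. e / 2 * (g t)\<^sup>2 + 1 / (2 * e)) integrable_on {0..L}"
      using integrable_on_cmult_left[OF i2(1), of "e/2"] by (intro integrable_add) auto
    have "norm (integral {0..x} g) \<le> integral {0..x} (\<lambda>t. e / 2 * (g t)\<^sup>2 + 1 / (2 * e))"
    proof (rule Henstock_Kurzweil_Integration.integral_norm_bound_integral)
      show "g integrable_on {0..x}" using L2_on_integrable_on[OF g] x by auto
      show "(\<lambda>t. e / 2 * (g t)\<^sup>2 + 1 / (2 * e)) integrable_on {0..x}"
        using x by (intro integrable_subinterval_real[OF ih]) auto
      fix t
      have "2 * (e * \<bar>g t\<bar>) * 1 \<le> (e * \<bar>g t\<bar>)\<^sup>2 + 1\<^sup>2"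
        by (rule sum_squares_bound)
      then show "norm (g t) \<le> e / 2 * (g t)\<^sup>2 + 1 / (2 * e)"
        using e by (simp add: field_simps power2_eq_square)
    qed
    also have "\<dots> \<le> integral {0..L} (\<lambda>t. e / 2 * (g t)\<^sup>2 + 1 / (2 * e))"
      using x e by (intro integral_subset_le integrable_subinterval_real[OF ih] ih) auto
    also have "\<dots> = e / 2 * N\<^sup>2 + L / (2 * e)"
      using L e by (subst integral_add)
        (auto simp: i2 intro!: integrable_on_cmult_left[OF i2(1)] integrable_const_ivl)
    finally show ?thesis using e by (simp add: field_simps)
  qed
  show ?thesis
  proof (cases "N = 0")
    case False
    then have "\<bar>integral {0..x} g\<bar> \<le> (1 / N * N\<^sup>2 + L / (1 / N)) / 2"
      using N0 by (intro key) simp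
    also have "\<dots> = (1 + L) / 2 * N"
      using False by (simp add: field_simps power2_eq_square)
    finally show ?thesis by (simp add: N_def)
  next
    case True
    have "\<bar>integral {0..x} g\<bar> \<le> 0 + e" if "e > 0" for e
    proof -
      have "L / ((L + 1) / e) / 2 \<le> e"
        using L that by (simp add: field_simps)
      then show ?thesis using key[of "(L + 1) / e"] that L True by simp
    qed
    then have "\<bar>integral {0..x} g\<bar> \<le> 0" by (rule field_le_epsilon)
    then show ?thesis using True by (simp add: N_def)
  qed
qed

section \<open>Iterated primitives and the Volterra equation\<close>

definition primitive :: "(real \<Rightarrow> real) \<Rightarrow> real \<Rightarrow> real" where
  "primitive w x = integral {0..x} w"

lemma continuous_on_primitive_iter:
  assumes "continuous_on {0..L} w"
  shows "continuous_on {0..L} ((primitive ^^ i) w)"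
proof (induction i)
  case 0
  then show ?case using assms by simp
next
  case (Suc i)
  then have "(primitive ^^ i) w integrable_on {0..L}"
    by (rule integrable_continuous_real)
  from indefinite_integral_continuous_1[OF this] show ?case
    by (simp add: primitive_def[abs_def])
qed

lemma primitive_iter_integrable:
  assumes "continuous_on {0..L} w" "x \<le> L"
  shows "(primitive ^^ i) w integrable_on {0..x}"
  using continuous_on_subset[OF continuous_on_primitive_iter[OF assms(1), of i], of "{0..x}"] assms(2)
  by (intro integrable_continuous_real) auto

lemma primitive_iter_diff:
  assumes "continuous_on {0..L} w" "continuous_on {0..L} v" "x \<in> {0..L}"
  shows "(primitive ^^ i) (\<lambda>t. w t - v t) x = (primitive ^^ i) w x - (primitive ^^ i) v x"
  using assms(3)
proof (induction i arbitrary: x)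
  case (Suc i)
  have "integral {0..x} ((primitive ^^ i) (\<lambda>t. w t - v t))
      = integral {0..x} (\<lambda>t. (primitive ^^ i) w t - (primitive ^^ i) v t)"
    using Suc by (intro Henstock_Kurzweil_Integration.integral_cong) auto
  also have "\<dots> = integral {0..x} ((primitive ^^ i) w) - integral {0..x} ((primitive ^^ i) v)"
    using Suc.prems primitive_iter_integrable[OF assms(1)] primitive_iter_integrable[OF assms(2)]
    by (intro Henstock_Kurzweil_Integration.integral_diff) auto
  finally show ?case by (simp add: primitive_def[where x=x])
qed simp

lemma primitive_exp_bound:
  assumes w: "w integrable_on {0..x}" and x: "0 \<le> x" and mu: "mu > 0" and A: "A \<ge> 0"
    and le: "\<And>t. t \<in> {0..x} \<Longrightarrow> \<bar>w t\<bar> \<le> A * exp (mu * t)"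
  shows "\<bar>primitive w x\<bar> \<le> A / mu * exp (mu * x)"
proof -
  have "((\<lambda>t. A * exp (mu * t)) has_integral (A / mu * exp (mu * x) - A / mu * exp (mu * 0))) {0..x}"
    using x mu by (intro fundamental_theorem_of_calculus)
      (auto intro!: derivative_eq_intros simp flip: has_real_derivative_iff_has_vector_derivative)
  note hi = this
  have "norm (integral {0..x} w) \<le> integral {0..x} (\<lambda>t. A * exp (mu * t))"
    using w le hi by (intro Henstock_Kurzweil_Integration.integral_norm_bound_integral) auto
  also have "\<dots> = A / mu * exp (mu * x) - A / mu * exp (mu * 0)"
    using hi by (rule integral_unique)
  finally have "\<bar>primitive w x\<bar> \<le> A / mu * exp (mu * x) - A / mu * exp (mu * 0)"
    by (simp add: primitive_def)
  then show ?thesis using A mu by (smt (verit) divide_nonneg_pos mult_nonneg_nonneg exp_ge_zero)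
qed

text \<open>One integration of \<open>exp (mu * t)\<close> gains the factor \<open>1/mu\<close>, and
  further ones do no harm because \<open>mu >= 1\<close>. Hence all terms of the Volterra sum obey
  the same bound, whatever their number of integrations.\<close>

lemma primitive_iter_exp_bound:
  assumes w: "continuous_on {0..L} w" and x: "x \<in> {0..L}" and mu: "mu \<ge> 1" and A: "A \<ge> 0"
    and le: "\<And>t. t \<in> {0..L} \<Longrightarrow> \<bar>w t\<bar> \<le> A * exp (mu * t)"
  shows "\<bar>(primitive ^^ i) w x\<bar> \<le> A * exp (mu * x)"
    and "\<bar>(primitive ^^ Suc i) w x\<bar> \<le> A / mu * exp (mu * x)"
proof -
  have step: "\<bar>(primitive ^^ Suc i) w x\<bar> \<le> A / mu * exp (mu * x)"
    if "\<And>t. t \<in> {0..L} \<Longrightarrow> \<bar>(primitive ^^ i) w t\<bar> \<le> A * exp (mu * t)" "x \<in> {0..L}" for i x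
    using that mu A primitive_exp_bound[OF primitive_iter_integrable[OF w]] by auto
  have *: "\<bar>(primitive ^^ i) w x\<bar> \<le> A * exp (mu * x)" if "x \<in> {0..L}" for i x
    using that
  proof (induction i arbitrary: x)
    case 0
    then show ?case using le by simp
  next
    case (Suc i)
    have "A / mu \<le> A" using mu A by (simp add: field_simps mult_le_cancel_left1)
    then have "A / mu * exp (mu * x) \<le> A * exp (mu * x)" by (intro mult_right_mono) auto
    with step[of i x] Suc show ?case by fastforce
  qed
  show "\<bar>(primitive ^^ i) w x\<bar> \<le> A * exp (mu * x)" using *[OF x] .
  show "\<bar>(primitive ^^ Suc i) w x\<bar> \<le> A / mu * exp (mu * x)" using step * x by blast
qed

text \<open>The weight \<open>exp (mu * t)\<close> makes the Volterra operator a contraction with constant \<open>1/2\<close>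
  on the whole interval.\<close>

lemma volterra_solution:
  fixes c :: "nat \<Rightarrow> real"
  assumes L: "L > 0" and F: "continuous_on {0..L} F"
    and B: "\<And>x. x \<in> {0..L} \<Longrightarrow> \<bar>F x\<bar> \<le> B"
    and mu: "mu = 1 + 2 * (\<Sum>k<n. \<bar>c k\<bar>)"
  obtains w where "continuous_on {0..L} w"
    and "\<And>x. x \<in> {0..L} \<Longrightarrow> w x = F x - (\<Sum>k<n. c k * (primitive ^^ (n-k)) w x)"
    and "\<And>x. x \<in> {0..L} \<Longrightarrow> \<bar>w x\<bar> \<le> 2 * B * exp (mu * x)"
proof -
  define C where "C = (\<Sum>k<n. \<bar>c k\<bar>)"
  have C0: "C \<ge> 0" unfolding C_def by (intro sum_nonneg) auto
  have mu1: "mu \<ge> 1" and Cmu: "C / mu \<le> 1/2"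
    using C0 unfolding mu C_def[symmetric] by (auto simp: field_simps)
  \<comment> \<open>Bounded continuous functions form a complete space here as functions on the
    whole line, so functions on the interval are extended by constants, by clamping the
    argument.\<close>
  define cl where "cl x = max 0 (min L x)" for x
  have cl: "cl x \<in> {0..L}" "x \<in> {0..L} \<Longrightarrow> cl x = x" for x
    using L by (auto simp: cl_def)
  \<comment> \<open>The fixed point is sought for \<open>v\<close>, the unknown divided by the
    weight, so that the plain supremum distance of \<open>v\<close> is the weighted distance of
    \<open>h v\<close>.\<close>
  define h where "h v t = exp (mu * t) * apply_bcontfun v t" for v :: "real \<Rightarrow>\<^sub>C real" and t
  have hc: "continuous_on {0..L} (h v)" for v
    unfolding h_def[abs_def] by (intro continuous_intros) auto
  define V where "V v x = (\<Sum>k<n. c k * (primitive ^^ (n-k)) v x)" for v x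
  have Vc: "continuous_on {0..L} (V v)" if "continuous_on {0..L} v" for v
    unfolding V_def[abs_def] by (intro continuous_intros continuous_on_primitive_iter that)
  have Vb: "\<bar>exp (- (mu * x)) * V v x\<bar> \<le> A / 2"
    if v: "continuous_on {0..L} v" and A: "A \<ge> 0" and x: "x \<in> {0..L}"
      and le: "\<And>t. t \<in> {0..L} \<Longrightarrow> \<bar>v t\<bar> \<le> A * exp (mu * t)" for v A x
  proof -
    have "\<bar>V v x\<bar> \<le> (\<Sum>k<n. \<bar>c k * (primitive ^^ (n-k)) v x\<bar>)"
      unfolding V_def by (rule sum_abs)
    also have "\<dots> \<le> (\<Sum>k<n. \<bar>c k\<bar> * (A / mu * exp (mu * x)))"
    proof (intro sum_mono)
      fix k assume "k \<in> {..<n}"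
      then obtain i where i: "n - k = Suc i" by (metis Suc_diff_Suc lessThan_iff)
      show "\<bar>c k * (primitive ^^ (n-k)) v x\<bar> \<le> \<bar>c k\<bar> * (A / mu * exp (mu * x))"
        unfolding abs_mult i by (intro mult_left_mono primitive_iter_exp_bound(2)[OF v x mu1 A le]) auto
    qed
    also have "\<dots> = exp (mu * x) * (A * (C / mu))"
      unfolding C_def sum_distrib_right[symmetric] by simp
    also have "\<dots> \<le> exp (mu * x) * (A * (1/2))"
      using Cmu A by (intro mult_left_mono) auto
    finally show ?thesis
      by (simp add: abs_mult exp_minus field_simps)
  qed
  define G where "G v x = exp (- (mu * cl x)) * (F (cl x) - V (h v) (cl x))" for v x
  have G: "G v \<in> bcontfun" for v
  proof -
    have f: "continuous_on {0..L} (\<lambda>x. exp (- (mu * x)) * (F x - V (h v) x))"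
      by (intro continuous_intros F Vc hc)
    have "continuous_on UNIV ((\<lambda>x. exp (- (mu * x)) * (F x - V (h v) x)) \<circ> cl)"
      by (intro continuous_on_compose continuous_on_subset[OF f])
         (use L in \<open>auto simp: cl_def[abs_def] intro!: continuous_intros\<close>)
    moreover have "bounded ((\<lambda>x. exp (- (mu * x)) * (F x - V (h v) x)) ` {0..L})"
      by (intro compact_imp_bounded compact_continuous_image f) auto
    then have "bounded (range ((\<lambda>x. exp (- (mu * x)) * (F x - V (h v) x)) \<circ> cl))"
      by (rule bounded_subset) (use cl(1) in auto)
    ultimately show ?thesis by (simp add: bcontfun_def G_def[abs_def] o_def)
  qed
  define T where "T v = Bcontfun (G v)" for v
  have T: "apply_bcontfun (T v) = G v" for v
    unfolding T_def by (rule Bcontfun_inverse[OF G])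
  have "\<exists>!v. T v = v"
  proof (rule banach_fix_type)
    show "\<forall>v u. dist (T v) (T u) \<le> 1/2 * dist v u"
    proof (intro allI dist_bound)
      fix v u x
      have "V (\<lambda>t. h v t - h u t) (cl x) = V (h v) (cl x) - V (h u) (cl x)"
        unfolding V_def using primitive_iter_diff[OF hc hc cl(1)]
        by (simp add: right_diff_distrib sum_subtractf)
      then have "dist (T v x) (T u x) = \<bar>exp (- (mu * cl x)) * V (\<lambda>t. h v t - h u t) (cl x)\<bar>"
        unfolding T G_def dist_real_def
        by (simp add: right_diff_distrib abs_minus_commute)
      also have "\<dots> \<le> dist v u / 2"
      proof (rule Vb[OF _ _ cl(1)])
        show "continuous_on {0..L} (\<lambda>t. h v t - h u t)" by (intro continuous_intros hc)
        fix t
        have "\<bar>h v t - h u t\<bar> = dist (v t) (u t) * exp (mu * t)"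
          by (simp add: h_def dist_real_def abs_mult flip: right_diff_distrib)
        also have "\<dots> \<le> dist v u * exp (mu * t)"
          by (intro mult_right_mono dist_bounded) auto
        finally show "\<bar>h v t - h u t\<bar> \<le> dist v u * exp (mu * t)" .
      qed simp
      finally show "dist (T v x) (T u x) \<le> 1/2 * dist v u" by simp
    qed
  qed auto
  then obtain v where v: "T v = v" by blast
  define M where "M = dist v (const_bcontfun 0)"
  have vM: "\<bar>v x\<bar> \<le> M" for x
    using dist_bounded[of v x "const_bcontfun 0"] by (simp add: M_def const_bcontfun.rep_eq)
  \<comment> \<open>The fixed point equation bounds \<open>v\<close> by the free term plus half of
    its own supremum, which yields the factor \<open>2\<close> in the final estimate.\<close>
  have "M \<le> B + M / 2"
    unfolding M_def
  proof (rule dist_bound)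
    fix x
    have "\<bar>exp (- (mu * cl x)) * V (h v) (cl x)\<bar> \<le> M / 2"
    proof (rule Vb[OF hc _ cl(1)])
      show "\<bar>h v t\<bar> \<le> M * exp (mu * t)" for t
        using vM[of t] by (simp add: h_def abs_mult)
    qed (simp add: M_def)
    moreover have "\<bar>exp (- (mu * cl x)) * F (cl x)\<bar> \<le> 1 * B"
      unfolding abs_mult using cl(1)[of x] mu1 by (intro mult_mono B) auto
    moreover have "v x = exp (- (mu * cl x)) * F (cl x) - exp (- (mu * cl x)) * V (h v) (cl x)"
      using T[of v] unfolding v by (simp add: G_def right_diff_distrib)
    ultimately show "dist (v x) (apply_bcontfun (const_bcontfun 0) x) \<le> B + dist v (const_bcontfun 0) / 2"
      by (simp add: const_bcontfun.rep_eq M_def)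
  qed
  then have M2: "M \<le> 2 * B" by simp
  show ?thesis
  proof (rule that[of "h v"])
    show "continuous_on {0..L} (h v)" by (rule hc)
    fix x assume x: "x \<in> {0..L}"
    have "v x = exp (- (mu * x)) * (F x - V (h v) x)"
      using T[of v] x unfolding v by (simp add: G_def cl)
    then show "h v x = F x - (\<Sum>k<n. c k * (primitive ^^ (n-k)) (h v) x)"
      unfolding V_def by (simp add: h_def exp_minus)
    show "\<bar>h v x\<bar> \<le> 2 * B * exp (mu * x)"
      using order_trans[OF vM[of x] M2] by (simp add: h_def abs_mult)
  qed
qed

text \<open>The equation is integrated once, so that \<open>g\<close> enters only through its
  continuous primitive. The unknown is the derivative of order \<open>n-1\<close>, a solution of the
  Volterra equation. Since \<open>K\<close> is fixed before \<open>g\<close>, the bound is uniform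
  in the data.\<close>

lemma initial_value_problem:
  fixes c :: "nat \<Rightarrow> real"
  assumes L: "L > 0"
  obtains K where "K \<ge> 0"
    and "\<And>g. L2_on L g \<Longrightarrow> \<exists>du. sobolev_H L n du \<and> (\<forall>k<n. du k 0 = 0) \<and>
           (\<forall>x. du n x = g x - (\<Sum>k<n. c k * du k x)) \<and>
           (\<forall>k<n. \<forall>x\<in>{0..L}. \<bar>du k x\<bar> \<le> K * L2_norm L g)"
proof -
  define mu where "mu = 1 + 2 * (\<Sum>k<n. \<bar>c k\<bar>)"
  have mu1: "mu \<ge> 1" by (simp add: mu_def sum_nonneg)
  define K where "K = (1 + L) * exp (mu * L)"
  have "\<exists>du. sobolev_H L n du \<and> (\<forall>k<n. du k 0 = 0) \<and>
           (\<forall>x. du n x = g x - (\<Sum>k<n. c k * du k x)) \<and>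
           (\<forall>k<n. \<forall>x\<in>{0..L}. \<bar>du k x\<bar> \<le> K * L2_norm L g)" if g: "L2_on L g" for g
  proof -
    define F where "F x = integral {0..x} g" for x
    define B where "B = (1 + L) / 2 * L2_norm L g"
    have B0: "B \<ge> 0" using L L2_norm_nonneg by (simp add: B_def)
    have Fc: "continuous_on {0..L} F"
      unfolding F_def[abs_def]
      by (intro indefinite_integral_continuous_1 L2_on_integrable_on[OF g]) simp
    have FB: "\<bar>F x\<bar> \<le> B" if "x \<in> {0..L}" for x
      using integral_le_L2_norm[OF _ g that] L by (simp add: F_def B_def)
    obtain w where wc: "continuous_on {0..L} w"
      and w: "\<And>x. x \<in> {0..L} \<Longrightarrow> w x = F x - (\<Sum>k<n. c k * (primitive ^^ (n-k)) w x)"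
      and wb: "\<And>x. x \<in> {0..L} \<Longrightarrow> \<bar>w x\<bar> \<le> 2 * B * exp (mu * x)"
      using volterra_solution[OF L Fc FB mu_def] by blast
    \<comment> \<open>Zero initial data make every lower derivative an iterated primitive of
      \<open>w\<close>.\<close>
    define y where "y k = (primitive ^^ (n-1-k)) w" for k
    \<comment> \<open>The derivative of order \<open>n\<close> is defined by the equation, which
      therefore holds at every point and not only almost everywhere.\<close>
    define du where "du k = (if k < n then y k else (\<lambda>x. g x - (\<Sum>k<n. c k * y k x)))" for k
    have yc: "continuous_on {0..L} (y k)" for k
      unfolding y_def by (rule continuous_on_primitive_iter[OF wc])
    have yi: "y k integrable_on {0..x}" if "x \<le> L" for k x
      unfolding y_def by (rule primitive_iter_integrable[OF wc that])
    have yS: "(primitive ^^ (n-k)) w = primitive (y k)" if "k < n" for k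
    proof -
      have "n - k = Suc (n-1-k)" using that by simp
      then show ?thesis by (simp add: y_def)
    qed
    have w0: "w 0 = 0"
      using w[of 0] L by (simp add: F_def yS primitive_def)
    have y0: "y k 0 = 0" for k
      by (cases "n-1-k") (auto simp: y_def w0 primitive_def)
    have step: "(du (Suc j) has_integral (du j x - du j 0)) {0..x}"
      if j: "j < n" and x: "x \<in> {0..L}" for j x
    proof (cases "Suc j < n")
      case True
      have "y j = primitive (y (Suc j))" using yS[of "Suc j"] True by (simp add: y_def)
      then have "du j x - du j 0 = integral {0..x} (y (Suc j))"
        using j by (simp add: du_def y0) (simp add: primitive_def)
      moreover have "du (Suc j) = y (Suc j)" using True by (simp add: du_def)
      ultimately show ?thesis using yi[of x "Suc j"] x by (simp add: integrable_integral)
    next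
      case False
      then have n: "n = Suc j" using j by simp
      have "((\<lambda>x. g x - (\<Sum>k<n. c k * y k x)) has_integral
          (F x - (\<Sum>k<n. c k * primitive (y k) x))) {0..x}"
        unfolding F_def primitive_def using x
        by (intro has_integral_diff has_integral_sum has_integral_mult_right integrable_integral
            L2_on_integrable_on[OF g] yi) auto
      \<comment> \<open>That the integral of the top derivative is the derivative below it is
        exactly the Volterra equation for \<open>w\<close>.\<close>
      moreover have "F x - (\<Sum>k<n. c k * primitive (y k) x) = w x"
        unfolding w[OF x] by (simp add: yS)
      moreover have "y j = w" by (simp add: y_def n)
      ultimately show ?thesis by (simp add: du_def n w0)
    qed
    have "L2_on L (\<lambda>x. 1 * g x + (-1) * (\<Sum>k<n. c k * y k x))"
      by (intro L2_on_linear_combination g continuous_on_imp_L2_on continuous_intros yc)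
    then have "L2_on L (du n)" by (simp add: du_def)
    then have "sobolev_H L n du"
      unfolding sobolev_H_def L2_on_def using step yc by (auto simp: du_def)
    moreover have "\<bar>du k x\<bar> \<le> K * L2_norm L g" if "k < n" "x \<in> {0..L}" for k x
    proof -
      have "\<bar>y k x\<bar> \<le> 2 * B * exp (mu * x)"
        unfolding y_def using B0 by (intro primitive_iter_exp_bound(1)[OF wc that(2) mu1 _ wb]) auto
      also have "\<dots> \<le> 2 * B * exp (mu * L)"
        using that mu1 B0 by (intro mult_left_mono) auto
      also have "\<dots> = K * L2_norm L g"
        by (simp add: K_def B_def)
      finally show ?thesis using that by (simp add: du_def)
    qed
    ultimately show ?thesis by (intro exI[of _ du]) (auto simp: du_def y0)
  qed
  moreover have "K \<ge> 0" using L by (simp add: K_def)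
  ultimately show ?thesis using that by blast
qed

section \<open>Two-point boundary value problems\<close>

text \<open>A square matrix with trivial kernel has nonzero determinant and is therefore
  invertible.\<close>

lemma matrix_right_inverse:
  fixes M :: "nat \<Rightarrow> nat \<Rightarrow> real"
  assumes ker: "\<And>v. (\<And>r. r < n \<Longrightarrow> (\<Sum>i<n. M r i * v i) = 0) \<Longrightarrow> (\<And>i. i < n \<Longrightarrow> v i = 0)"
  shows "\<exists>N. \<forall>r<n. \<forall>s<n. (\<Sum>i<n. M r i * N i s) = (if r = s then 1 else 0)"
proof -
  define A where "A = Matrix.mat n n (\<lambda>(r,i). M r i)"
  have A: "A \<in> carrier_mat n n" by (simp add: A_def)
  have "Determinant.det A \<noteq> 0"
  proof
    assume "Determinant.det A = 0"
    then obtain v where v: "v \<in> carrier_vec n" "v \<noteq> 0\<^sub>v n" "A *\<^sub>v v = 0\<^sub>v n"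
      using det_0_iff_vec_prod_zero_field[OF A] by auto
    have "vec_index v i = 0" if "i < n" for i
    proof (rule ker[OF _ that])
      fix r assume r: "r < n"
      have "vec_index (A *\<^sub>v v) r = (\<Sum>i<n. M r i * vec_index v i)"
        using r v(1) A by (simp add: A_def scalar_prod_def lessThan_atLeast0)
      then show "(\<Sum>i<n. M r i * vec_index v i) = 0" using v(3) r by simp
    qed
    then have "v = 0\<^sub>v n" using v(1) by (intro eq_vecI) auto
    with v(2) show False by simp
  qed
  \<comment> \<open>The argument \<open>undefined\<close> merely fills the extension slot of the
    record that represents the matrix ring.\<close>
  from det_non_zero_imp_unit[OF A this, of undefined]
  obtain B where B: "B \<in> carrier_mat n n" "A * B = 1\<^sub>m n"
    by (auto simp: Units_def ring_mat_def)
  have "(\<Sum>i<n. M r i * B $$ (i,s)) = (if r = s then 1 else 0)" if "r < n" "s < n" for r s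
  proof -
    have "(A * B) $$ (r,s) = (\<Sum>i<n. M r i * B $$ (i,s))"
      using that B(1) A by (simp add: A_def scalar_prod_def lessThan_atLeast0)
    with B(2) that show ?thesis by simp
  qed
  then show ?thesis by (intro exI[of _ "\<lambda>i s. B $$ (i,s)"]) auto
qed

section \<open>Linearity of the equation and of the boundary functionals\<close>

lemma sobolev_H_linear_combination:
  assumes "sobolev_H L m du" "sobolev_H L m dv"
  shows "sobolev_H L m (\<lambda>k x. r * du k x + s * dv k x)"
proof -
  have "L2_on L (\<lambda>x. r * du m x + s * dv m x)"
    using assms by (intro L2_on_linear_combination) (auto simp: sobolev_H_def L2_on_def)
  moreover have "((\<lambda>x. r * du (Suc j) x + s * dv (Suc j) x) has_integral
      r * du j x + s * dv j x - (r * du j 0 + s * dv j 0)) {0..x}"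
    if "j < m" "x \<in> {0..L}" for j x
  proof -
    have "((\<lambda>x. r * du (Suc j) x + s * dv (Suc j) x) has_integral
      r * (du j x - du j 0) + s * (dv j x - dv j 0)) {0..x}"
      using assms that unfolding sobolev_H_def
      by (intro has_integral_add has_integral_mult_right) auto
    then show ?thesis by (simp add: algebra_simps)
  qed
  ultimately show ?thesis
    using assms unfolding sobolev_H_def L2_on_def
    by (auto intro!: continuous_intros)
qed

lemma sobolev_H_L2_on: "sobolev_H L m du \<Longrightarrow> L2_on L (du m)"
  by (simp add: sobolev_H_def L2_on_def)

definition solves_ode ::
  "real \<Rightarrow> nat \<Rightarrow> (nat \<Rightarrow> real) \<Rightarrow> (real \<Rightarrow> real) \<Rightarrow> (nat \<Rightarrow> real \<Rightarrow> real) \<Rightarrow> bool" where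
  "solves_ode L n c g du \<longleftrightarrow> sobolev_H L n du \<and>
     (AE x in lborel. x \<in> {0<..<L} \<longrightarrow> du n x + (\<Sum>k<n. c k * du k x) = g x)"

lemma solves_ode_linear_combination:
  assumes "solves_ode L n c g du" "solves_ode L n c h dv"
  shows "solves_ode L n c (\<lambda>x. r * g x + s * h x) (\<lambda>k x. r * du k x + s * dv k x)"
proof -
  have "AE x in lborel. x \<in> {0<..<L} \<longrightarrow> r * du n x + s * dv n x
      + (\<Sum>k<n. c k * (r * du k x + s * dv k x)) = r * g x + s * h x"
    using assms[unfolded solves_ode_def, THEN conjunct2]
  proof eventually_elim
    case (elim x)
    have "r * du n x + s * dv n x + (\<Sum>k<n. c k * (r * du k x + s * dv k x))
       = r * (du n x + (\<Sum>k<n. c k * du k x)) + s * (dv n x + (\<Sum>k<n. c k * dv k x))"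
      by (simp add: algebra_simps sum.distrib sum_distrib_left)
    then show ?case using elim by simp
  qed
  then show ?thesis
    using assms sobolev_H_linear_combination unfolding solves_ode_def by blast
qed

lemma solves_ode_sum:
  fixes m :: nat
  assumes "\<And>i. i < m \<Longrightarrow> solves_ode L n c (\<lambda>_. 0) (u i)"
  shows "solves_ode L n c (\<lambda>_. 0) (\<lambda>k x. \<Sum>i<m. d i * u i k x)"
  using assms
proof (induction m)
  case 0
  have "sobolev_H L n (\<lambda>k x. 0)"
    by (auto simp: sobolev_H_def set_borel_measurable_def set_integrable_def)
  then show ?case by (simp add: solves_ode_def)
next
  case (Suc m)
  then have "solves_ode L n c (\<lambda>x. 1 * 0 + d m * 0) (\<lambda>k x. 1 * (\<Sum>i<m. d i * u i k x) + d m * u m k x)"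
    by (intro solves_ode_linear_combination) auto
  then show ?case by simp
qed

text \<open>Orders stop below \<open>n\<close> because \<open>sobolev_H L n\<close> makes exactly
  these derivatives continuous, so that their end point values are meaningful.\<close>

definition two_point ::
  "real \<Rightarrow> nat \<Rightarrow> (nat \<Rightarrow> real) \<Rightarrow> (nat \<Rightarrow> real) \<Rightarrow> (nat \<Rightarrow> real \<Rightarrow> real) \<Rightarrow> real" where
  "two_point L n \<alpha> \<beta> du = (\<Sum>k<n. \<alpha> k * du k 0 + \<beta> k * du k L)"

lemma two_point_linear_combination:
  "two_point L n \<alpha> \<beta> (\<lambda>k x. r * du k x + s * dv k x)
     = r * two_point L n \<alpha> \<beta> du + s * two_point L n \<alpha> \<beta> dv"
  by (simp add: two_point_def sum_distrib_left sum.distrib[symmetric] algebra_simps)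

lemma two_point_sum:
  fixes m :: nat
  shows "two_point L n \<alpha> \<beta> (\<lambda>k x. \<Sum>i<m. d i * u i k x) = (\<Sum>i<m. d i * two_point L n \<alpha> \<beta> (u i))"
proof (induction m)
  case (Suc m)
  have "two_point L n \<alpha> \<beta> (\<lambda>k x. 1 * (\<Sum>i<m. d i * u i k x) + d m * u m k x)
      = 1 * two_point L n \<alpha> \<beta> (\<lambda>k x. \<Sum>i<m. d i * u i k x) + d m * two_point L n \<alpha> \<beta> (u m)"
    by (rule two_point_linear_combination)
  then show ?case using Suc by simp
qed (simp add: two_point_def)

definition monomial_jet :: "nat \<Rightarrow> nat \<Rightarrow> real \<Rightarrow> real" where
  "monomial_jet i k x = (if k \<le> i then x ^ (i-k) / fact (i-k) else 0)"

lemma monomial_jet_0: "monomial_jet i k 0 = (if k = i then 1 else 0)"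
  by (auto simp: monomial_jet_def power_0_left)

lemma continuous_on_monomial_jet: "continuous_on S (monomial_jet i k)"
  unfolding monomial_jet_def[abs_def] by (cases "k \<le> i") (auto intro!: continuous_intros)

lemma monomial_jet_deriv: "(monomial_jet i k has_real_derivative monomial_jet i (Suc k) x) (at x within S)"
proof (cases "k < i")
  case True
  then obtain m where m: "i - k = Suc m" by (metis Suc_diff_Suc)
  then have m': "i - Suc k = m" by simp
  have "((\<lambda>x. x ^ Suc m / fact (Suc m)) has_real_derivative x ^ m / fact m) (at x within S)"
    by (rule derivative_eq_intros refl | simp)+
  then show ?thesis using True unfolding monomial_jet_def[abs_def] by (simp add: m m')
next
  case False
  then have "monomial_jet i k = (\<lambda>_. if k = i then 1 else 0)" "monomial_jet i (Suc k) x = 0"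
    by (auto simp: monomial_jet_def fun_eq_iff)
  then show ?thesis by simp
qed

lemma sobolev_H_monomial_jet: "sobolev_H L m (monomial_jet i)"
proof -
  have "(monomial_jet i (Suc j) has_integral (monomial_jet i j x - monomial_jet i j 0)) {0..x}"
    if "x \<in> {0..L}" for j x
    using that by (intro fundamental_theorem_of_calculus)
      (auto simp: monomial_jet_deriv simp flip: has_real_derivative_iff_has_vector_derivative)
  moreover have "L2_on L (monomial_jet i m)"
    by (intro continuous_on_imp_L2_on continuous_on_monomial_jet)
  ultimately show ?thesis by (auto simp: sobolev_H_def L2_on_def continuous_on_monomial_jet)
qed

text \<open>The polynomial \<open>x^i / i!\<close> has the required initial jet, and as
  \<open>i < n\<close> its derivative of order \<open>n\<close> is zero. Adding the solution with
  zero initial data that cancels the remaining terms leaves this jet unchanged.\<close>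

lemma fundamental_system:
  fixes c :: "nat \<Rightarrow> real"
  assumes L: "L > 0"
  obtains u where "\<And>i. i < n \<Longrightarrow> solves_ode L n c (\<lambda>_. 0) (u i)"
    and "\<And>i k. i < n \<Longrightarrow> k < n \<Longrightarrow> u i k 0 = (if k = i then 1 else 0)"
proof -
  have "\<exists>du. solves_ode L n c (\<lambda>_. 0) du \<and> (\<forall>k<n. du k 0 = (if k = i then 1 else 0))" if "i < n" for i
  proof -
    define g where "g x = - (\<Sum>k<n. c k * monomial_jet i k x)" for x
    have "L2_on L g"
      unfolding g_def[abs_def]
      by (intro continuous_on_imp_L2_on continuous_intros continuous_on_monomial_jet)
    with initial_value_problem[OF L, of n c] obtain v where v: "sobolev_H L n v" "\<forall>k<n. v k 0 = 0"
      "\<And>x. v n x = g x - (\<Sum>k<n. c k * v k x)" by metis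
    have "sobolev_H L n (\<lambda>k x. 1 * monomial_jet i k x + 1 * v k x)"
      by (intro sobolev_H_linear_combination sobolev_H_monomial_jet v)
    moreover have "monomial_jet i n x = 0" for x using that by (simp add: monomial_jet_def)
    ultimately have "solves_ode L n c (\<lambda>_. 0) (\<lambda>k x. monomial_jet i k x + v k x)"
      by (simp add: solves_ode_def v(3) g_def distrib_left sum.distrib)
    then show ?thesis using v(2) monomial_jet_0
      by (intro exI[of _ "\<lambda>k x. monomial_jet i k x + v k x"]) auto
  qed
  then show ?thesis using that by metis
qed

text \<open>The matrix \<open>M\<close> holds the boundary values of the fundamental system. A
  kernel vector \<open>v\<close> gives a homogeneous solution with zero boundary values; by
  \<open>uniq\<close> this solution vanishes, and its initial jet is \<open>v\<close> itself. So
  \<open>M\<close> is invertible, and all constants built from its inverse are available before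
  \<open>g\<close> is chosen.\<close>

theorem two_point_problem:
  fixes c :: "nat \<Rightarrow> real" and \<alpha> \<beta> :: "nat \<Rightarrow> nat \<Rightarrow> real"
  assumes L: "L > 0"
    and uniq: "\<And>du. solves_ode L n c (\<lambda>_. 0) du \<Longrightarrow>
        (\<And>r. r < n \<Longrightarrow> two_point L n (\<alpha> r) (\<beta> r) du = 0) \<Longrightarrow>
        (\<And>k x. k < n \<Longrightarrow> x \<in> {0..L} \<Longrightarrow> du k x = 0)"
  obtains K where "K \<ge> 0"
    and "\<And>g. L2_on L g \<Longrightarrow> \<exists>du. solves_ode L n c g du \<and>
           (\<forall>r<n. two_point L n (\<alpha> r) (\<beta> r) du = 0) \<and>
           (\<forall>k<n. \<forall>x\<in>{0..L}. \<bar>du k x\<bar> \<le> K * L2_norm L g)"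
proof -
  obtain u where u: "\<And>i. i < n \<Longrightarrow> solves_ode L n c (\<lambda>_. 0) (u i)"
    and u0: "\<And>i k. i < n \<Longrightarrow> k < n \<Longrightarrow> u i k 0 = (if k = i then 1 else 0)"
    using fundamental_system[OF L, of n c] by metis
  define M where "M r i = two_point L n (\<alpha> r) (\<beta> r) (u i)" for r i
  have "\<exists>N. \<forall>r<n. \<forall>s<n. (\<Sum>i<n. M r i * N i s) = (if r = s then 1 else 0)"
  proof (rule matrix_right_inverse)
    fix v :: "nat \<Rightarrow> real" and k
    assume v: "\<And>r. r < n \<Longrightarrow> (\<Sum>i<n. M r i * v i) = 0" and k: "k < n"
    have "(\<Sum>i<n. v i * u i k 0) = 0"
    proof (rule uniq[OF solves_ode_sum[OF u]])
      show "two_point L n (\<alpha> r) (\<beta> r) (\<lambda>k x. \<Sum>i<n. v i * u i k x) = 0" if "r < n" for r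
        unfolding two_point_sum using v[OF that] by (simp add: M_def mult.commute)
    qed (use k L in auto)
    moreover have "(\<Sum>i<n. v i * u i k 0) = (\<Sum>i<n. if k = i then v i else 0)"
      using k u0 by (intro sum.cong) auto
    ultimately show "v k = 0" using k by simp
  qed
  then obtain N where N: "\<And>r s. r < n \<Longrightarrow> s < n \<Longrightarrow> (\<Sum>i<n. M r i * N i s) = (if r = s then 1 else 0)"
    by blast
  have "\<exists>\<Phi>. \<forall>x\<in>{0..L}. \<bar>u i k x\<bar> \<le> \<Phi>" if "i < n" "k < n" for i k
  proof -
    have "continuous_on {0..L} (u i k)"
      using u[OF that(1)] that(2) by (simp add: solves_ode_def sobolev_H_def)
    then have "bounded (u i k ` {0..L})"
      by (intro compact_imp_bounded compact_continuous_image) auto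
    then show ?thesis by (auto simp: bounded_iff)
  qed
  then have "\<forall>i k. \<exists>\<Phi>. i < n \<longrightarrow> k < n \<longrightarrow> (\<forall>x\<in>{0..L}. \<bar>u i k x\<bar> \<le> \<Phi>)"
    by blast
  then obtain \<Phi> where "\<forall>i k. i < n \<longrightarrow> k < n \<longrightarrow> (\<forall>x\<in>{0..L}. \<bar>u i k x\<bar> \<le> \<Phi> i k)"
    unfolding choice_iff by blast
  then have \<Phi>: "\<bar>u i k x\<bar> \<le> \<Phi> i k" if "i < n" "k < n" "x \<in> {0..L}" for i k x
    using that by blast
  obtain K\<^sub>0 where K0: "K\<^sub>0 \<ge> 0" and ivp: "\<And>g. L2_on L g \<Longrightarrow> \<exists>du. sobolev_H L n du \<and> (\<forall>k<n. du k 0 = 0) \<and>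
           (\<forall>x. du n x = g x - (\<Sum>k<n. c k * du k x)) \<and>
           (\<forall>k<n. \<forall>x\<in>{0..L}. \<bar>du k x\<bar> \<le> K\<^sub>0 * L2_norm L g)"
    using initial_value_problem[OF L, where n=n and c=c] by blast
  define Q where "Q r = (\<Sum>k<n. \<bar>\<alpha> r k\<bar> + \<bar>\<beta> r k\<bar>)" for r
  define D where "D i = (\<Sum>s<n. \<bar>N i s\<bar> * Q s)" for i
  \<comment> \<open>If \<open>G\<close> bounds the jet of the particular solution, then
    \<open>Q r * G\<close> bounds its boundary values and \<open>D i * G\<close> the correcting
    coefficients. The outer sum over \<open>k\<close> stands in for a maximum.\<close>
  define K where "K = K\<^sub>0 * (1 + (\<Sum>k<n. \<Sum>i<n. D i * \<bar>\<Phi> i k\<bar>))"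
  have D0: "D i \<ge> 0" for i
    unfolding D_def Q_def by (intro sum_nonneg mult_nonneg_nonneg) auto
  have "\<exists>du. solves_ode L n c g du \<and> (\<forall>r<n. two_point L n (\<alpha> r) (\<beta> r) du = 0) \<and>
           (\<forall>k<n. \<forall>x\<in>{0..L}. \<bar>du k x\<bar> \<le> K * L2_norm L g)" if g: "L2_on L g" for g
  proof -
    define G where "G = K\<^sub>0 * L2_norm L g"
    have G0: "G \<ge> 0" using K0 L2_norm_nonneg by (simp add: G_def)
    from ivp[OF g] obtain w where w: "sobolev_H L n w" "\<And>x. w n x = g x - (\<Sum>k<n. c k * w k x)"
      and wb: "\<And>k x. k < n \<Longrightarrow> x \<in> {0..L} \<Longrightarrow> \<bar>w k x\<bar> \<le> G" unfolding G_def by metis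
    have ws: "solves_ode L n c g w" using w by (simp add: solves_ode_def)
    define q where "q r = two_point L n (\<alpha> r) (\<beta> r) w" for r
    have q: "\<bar>q r\<bar> \<le> Q r * G" for r
    proof -
      have "\<bar>q r\<bar> \<le> (\<Sum>k<n. \<bar>\<alpha> r k * w k 0 + \<beta> r k * w k L\<bar>)"
        unfolding q_def two_point_def by (rule sum_abs)
      also have "\<dots> \<le> (\<Sum>k<n. (\<bar>\<alpha> r k\<bar> + \<bar>\<beta> r k\<bar>) * G)"
      proof (intro sum_mono)
        fix k assume "k \<in> {..<n}"
        then have "\<bar>\<alpha> r k * w k 0\<bar> \<le> \<bar>\<alpha> r k\<bar> * G" "\<bar>\<beta> r k * w k L\<bar> \<le> \<bar>\<beta> r k\<bar> * G"
          unfolding abs_mult using wb[of k] L by (auto intro!: mult_left_mono)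
        then show "\<bar>\<alpha> r k * w k 0 + \<beta> r k * w k L\<bar> \<le> (\<bar>\<alpha> r k\<bar> + \<bar>\<beta> r k\<bar>) * G"
          unfolding distrib_right by linarith
      qed
      finally show ?thesis by (simp add: Q_def sum_distrib_right)
    qed
    \<comment> \<open>Applying \<open>M\<close> to these coefficients gives \<open>-q\<close>, the
      negative of the boundary values of \<open>w\<close>.\<close>
    define d where "d i = - (\<Sum>s<n. N i s * q s)" for i
    have d: "\<bar>d i\<bar> \<le> D i * G" for i
    proof -
      have "\<bar>d i\<bar> \<le> (\<Sum>s<n. \<bar>N i s * q s\<bar>)"
        unfolding d_def abs_minus_cancel by (rule sum_abs)
      also have "\<dots> \<le> (\<Sum>s<n. \<bar>N i s\<bar> * (Q s * G))"
        unfolding abs_mult by (intro sum_mono mult_left_mono q) auto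
      finally show ?thesis by (simp add: D_def sum_distrib_right mult.assoc)
    qed
    define du where "du k x = 1 * w k x + 1 * (\<Sum>i<n. d i * u i k x)" for k x
    have "solves_ode L n c (\<lambda>x. 1 * g x + 1 * 0) du"
      unfolding du_def[abs_def] by (intro solves_ode_linear_combination ws solves_ode_sum u)
    then have "solves_ode L n c g du" by simp
    moreover have "two_point L n (\<alpha> r) (\<beta> r) du = 0" if r: "r < n" for r
    proof -
      have "two_point L n (\<alpha> r) (\<beta> r) du = q r + (\<Sum>i<n. d i * M r i)"
        unfolding du_def[abs_def] two_point_linear_combination two_point_sum by (simp add: q_def M_def)
      also have "(\<Sum>i<n. d i * M r i) = - (\<Sum>i<n. \<Sum>s<n. M r i * N i s * q s)"
        by (simp add: d_def sum_negf sum_distrib_left sum_distrib_right mult_ac)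
      also have "(\<Sum>i<n. \<Sum>s<n. M r i * N i s * q s) = (\<Sum>s<n. (\<Sum>i<n. M r i * N i s) * q s)"
        unfolding sum_distrib_right by (rule sum.swap)
      also have "\<dots> = (\<Sum>s<n. if r = s then q s else 0)"
        using N[OF r] by (intro sum.cong) auto
      finally show ?thesis using r by simp
    qed
    moreover have "\<bar>du k x\<bar> \<le> K * L2_norm L g" if k: "k < n" and x: "x \<in> {0..L}" for k x
    proof -
      have "\<bar>\<Sum>i<n. d i * u i k x\<bar> \<le> (\<Sum>i<n. \<bar>d i * u i k x\<bar>)" by (rule sum_abs)
      also have "\<dots> \<le> (\<Sum>i<n. (D i * G) * \<bar>\<Phi> i k\<bar>)"
      proof (intro sum_mono)
        fix i assume "i \<in> {..<n}"
        then have "\<bar>u i k x\<bar> \<le> \<bar>\<Phi> i k\<bar>" using \<Phi>[of i k x] k x by auto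
        then show "\<bar>d i * u i k x\<bar> \<le> D i * G * \<bar>\<Phi> i k\<bar>"
          unfolding abs_mult using D0 G0 d by (intro mult_mono) auto
      qed
      also have "\<dots> = G * (\<Sum>i<n. D i * \<bar>\<Phi> i k\<bar>)"
        by (simp add: sum_distrib_left mult_ac)
      also have "\<dots> \<le> G * (\<Sum>k<n. \<Sum>i<n. D i * \<bar>\<Phi> i k\<bar>)"
        using k D0 G0
        by (intro mult_left_mono member_le_sum[where f="\<lambda>k. \<Sum>i<n. D i * \<bar>\<Phi> i k\<bar>"])
           (auto intro!: sum_nonneg)
      finally have "\<bar>du k x\<bar> \<le> G + G * (\<Sum>k<n. \<Sum>i<n. D i * \<bar>\<Phi> i k\<bar>)"
        using wb[OF k x] unfolding du_def by linarith
      then show ?thesis by (simp add: K_def G_def algebra_simps)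
    qed
    ultimately show ?thesis by blast
  qed
  moreover have "K \<ge> 0"
    using K0 D0 unfolding K_def by (intro mult_nonneg_nonneg add_nonneg_nonneg sum_nonneg) auto
  ultimately show ?thesis using that by blast
qed

section \<open>The odd-order problem\<close>

text \<open>For \<open>k = 2*j+1\<close> the exponent is \<open>j+1\<close>, so the value does not
  depend on \<open>l\<close>. Raising \<open>l\<close> only appends coefficients, which makes the
  induction in \<open>kdv_coeff_sum\<close> possible.\<close>

definition kdv_coeff :: "real \<Rightarrow> nat \<Rightarrow> real" where
  "kdv_coeff lam k =
     (if k = 0 then lam else if odd k \<and> 3 \<le> k then (-1) ^ ((k-1) div 2 + 1) else 0)"

lemma kdv_coeff_sum:
  assumes "l \<ge> 1"
  shows "(\<Sum>k<2*l+1. kdv_coeff lam k * y k) = lam * y 0 + (\<Sum>j=1..<l. (-1)^(j+1) * y (2*j+1))"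
  using assms
proof (induction l rule: nat_induct_at_least)
  case base
  show ?case by (simp add: kdv_coeff_def eval_nat_numeral)
next
  case (Suc l)
  have "(\<Sum>k<2*Suc l+1. kdv_coeff lam k * y k) = (\<Sum>k<2*l+1. kdv_coeff lam k * y k)
      + kdv_coeff lam (2*l+1) * y (2*l+1) + kdv_coeff lam (2*l+2) * y (2*l+2)"
    by simp
  moreover have "kdv_coeff lam (2*l+1) = (-1)^(l+1)" "kdv_coeff lam (2*l+2) = 0"
    using Suc.hyps by (auto simp: kdv_coeff_def)
  ultimately show ?case using Suc by simp
qed

text \<open>The leading coefficient of the differential operator is \<open>(-1)^(l+1)\<close>, so multiplying the
  equation by this sign makes it monic.\<close>

lemma kdv_equation_iff:
  fixes z :: real
  assumes "l \<ge> 1"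
  shows "lam * y 0 + (\<Sum>j=1..l. (-1)^(j+1) * y (2*j+1)) = z \<longleftrightarrow>
     y (2*l+1) + (\<Sum>k<2*l+1. ((-1)^(l+1) * kdv_coeff lam k) * y k) = (-1)^(l+1) * z"
proof -
  define s :: real where "s = (-1)^(l+1)"
  have ss: "s * s = 1" by (simp add: s_def flip: power_add mult_2)
  have "{1..l} = insert l {1..<l}" using assms by auto
  then have "lam * y 0 + (\<Sum>j=1..l. (-1)^(j+1) * y (2*j+1))
      = (\<Sum>k<2*l+1. kdv_coeff lam k * y k) + s * y (2*l+1)"
    unfolding kdv_coeff_sum[OF assms] s_def by simp
  moreover have "(\<Sum>k<2*l+1. (s * kdv_coeff lam k) * y k) = s * (\<Sum>k<2*l+1. kdv_coeff lam k * y k)"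
    by (simp only: sum_distrib_left mult.assoc)
  moreover have "A + s * B = z \<longleftrightarrow> B + s * A = s * z" for A B
  proof
    assume "A + s * B = z"
    then have "s * z = s * A + (s * s) * B" by (auto simp: distrib_left mult.assoc)
    then show "B + s * A = s * z" by (simp add: ss)
  next
    assume "B + s * A = s * z"
    then have "s * (B + s * A) = (s * s) * z" by simp
    then have "s * B + (s * s) * A = (s * s) * z" by (simp add: distrib_left mult.assoc)
    then show "A + s * B = z" by (simp add: ss)
  qed
  ultimately show ?thesis unfolding s_def[symmetric] by simp
qed

section \<open>The boundary conditions as linear functionals\<close>

definition pair_row :: "real \<Rightarrow> nat \<Rightarrow> real \<Rightarrow> nat \<Rightarrow> nat \<Rightarrow> real" where
  "pair_row A p B q k = (if k = p then A else 0) + (if k = q then B else 0)"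

lemma sum_pair_row:
  assumes "p < n" "q < n"
  shows "(\<Sum>k<n. pair_row A p B q k * z k) = A * z p + B * z q"
proof -
  have "(\<Sum>k<n. pair_row A p B q k * z k)
      = (\<Sum>k<n. (if k = p then A * z k else 0) + (if k = q then B * z k else 0))"
    by (intro sum.cong) (auto simp: pair_row_def distrib_right)
  then show ?thesis using assms by (simp add: sum.distrib)
qed

text \<open>Row \<open>0\<close> is \<open>u(0) = 0\<close>, rows \<open>1\<close>, \<open>2\<close> are \<open>u(L) = 0\<close>, \<open>D^l u(L) = 0\<close>, rows \<open>3..l+1\<close> are the
  conditions with coefficients \<open>a\<close> at \<open>0\<close> and rows \<open>l+2..2l\<close> those with coefficients \<open>b\<close> at \<open>L\<close>.\<close>

definition left_rows :: "nat \<Rightarrow> (nat \<Rightarrow> nat \<Rightarrow> real) \<Rightarrow> nat \<Rightarrow> nat \<Rightarrow> real" where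
  "left_rows l a r =
     (if r = 0 then pair_row 1 0 0 0
      else if 3 \<le> r \<and> r \<le> l+1
        then pair_row 1 (l+(r-2)) (- a (l+(r-2)) (l-(r-2))) (l-(r-2)) else (\<lambda>_. 0))"

definition right_rows :: "nat \<Rightarrow> (nat \<Rightarrow> nat \<Rightarrow> real) \<Rightarrow> nat \<Rightarrow> nat \<Rightarrow> real" where
  "right_rows l b r =
     (if r = 1 then pair_row 1 0 0 0 else if r = 2 then pair_row 1 l 0 0
      else if l+2 \<le> r
        then pair_row 1 (l+(r-l-1)) (- b (l+(r-l-1)) (l-(r-l-1))) (l-(r-l-1)) else (\<lambda>_. 0))"

lemma boundary_conditions_iff:
  assumes l: "l \<ge> 2"
  shows "(\<forall>r<2*l+1. two_point L (2*l+1) (left_rows l a r) (right_rows l b r) du = 0) \<longleftrightarrow>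
     du 0 0 = 0 \<and> du 0 L = 0 \<and> du l L = 0 \<and>
     (\<forall>j\<in>{1..l-1}. du (l+j) 0 = a (l+j) (l-j) * du (l-j) 0 \<and>
                    du (l+j) L = b (l+j) (l-j) * du (l-j) L)" (is "?lhs \<longleftrightarrow> ?rhs")
proof -
  let ?B = "\<lambda>r. two_point L (2*l+1) (left_rows l a r) (right_rows l b r) du"
  have B: "?B r = (\<Sum>k<2*l+1. left_rows l a r k * du k 0) + (\<Sum>k<2*l+1. right_rows l b r k * du k L)" for r
    by (simp add: two_point_def sum.distrib)
  have B0: "?B 0 = du 0 0" and B1: "?B 1 = du 0 L" and B2: "?B 2 = du l L"
    using l unfolding B by (auto simp: left_rows_def right_rows_def sum_pair_row simp del: sum.lessThan_Suc)
  have Ba: "?B (j+2) = du (l+j) 0 - a (l+j) (l-j) * du (l-j) 0" if "j \<in> {1..l-1}" for j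
    using l that unfolding B by (auto simp: left_rows_def right_rows_def sum_pair_row simp del: sum.lessThan_Suc)
  have Bb: "?B (l+1+j) = du (l+j) L - b (l+j) (l-j) * du (l-j) L" if "j \<in> {1..l-1}" for j
    using l that unfolding B by (auto simp: left_rows_def right_rows_def sum_pair_row simp del: sum.lessThan_Suc)
  show ?thesis
  proof
    assume h: ?lhs
    have "du (l+j) 0 = a (l+j) (l-j) * du (l-j) 0 \<and> du (l+j) L = b (l+j) (l-j) * du (l-j) L"
      if j: "j \<in> {1..l-1}" for j
    proof -
      have "j + 2 < 2*l+1" "l+1+j < 2*l+1" using j l by auto
      with h Ba[OF j] Bb[OF j] show ?thesis by force
    qed
    moreover have "0 < 2*l+1" "1 < 2*l+1" "2 < 2*l+1" using l by auto
    ultimately show ?rhs using h B0 B1 B2 by metis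
  next
    assume h: ?rhs
    show ?lhs
    proof (intro allI impI)
      fix r assume r: "r < 2*l+1"
      consider "r = 0" | "r = 1" | "r = 2" | "3 \<le> r" "r \<le> l+1" | "l+2 \<le> r" by linarith
      then show "?B r = 0"
      proof cases
        case 4
        then obtain j where j: "j \<in> {1..l-1}" "r = j+2" by (intro that[of "r-2"]) auto
        then show ?thesis using h Ba[OF j(1)] unfolding j(2) by simp
      next
        case 5
        then obtain j where j: "j \<in> {1..l-1}" "r = l+1+j" using r by (intro that[of "r-l-1"]) auto
        then show ?thesis using h Bb[OF j(1)] unfolding j(2) by simp
      qed (use h B0 B1 B2 in auto)
    qed
  qed
qed

lemma is_solution_iff:
  assumes "l \<ge> 2"
  shows "is_solution L l lam a b f du \<longleftrightarrow>
     solves_ode L (2*l+1) (\<lambda>k. (-1)^(l+1) * kdv_coeff lam k) (\<lambda>x. (-1)^(l+1) * f x) du \<and>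
     (\<forall>r<2*l+1. two_point L (2*l+1) (left_rows l a r) (right_rows l b r) du = 0)"
proof -
  have "1 \<le> l" using assms by simp
  note eq = kdv_equation_iff[OF this, of lam "\<lambda>k. du k x" "f x" for x]
  show ?thesis
    unfolding is_solution_def solves_ode_def boundary_conditions_iff[OF assms] eq by blast
qed

text \<open>The regularity step: integrals ignore null sets, so \<open>u\<close> is also a primitive
  of the continuous \<open>h\<close> and hence classically differentiable, one-sidedly at the ends.
  The end points join the exceptional set because the equation is given only inside the
  interval.\<close>

lemma primitive_of_AE_continuous_has_real_derivative:
  assumes int: "\<And>x. x \<in> {0..L} \<Longrightarrow> (v has_integral (u x - u 0)) {0..x}"
    and h: "continuous_on {0..L} h" and ae: "AE x in lborel. x \<in> {0<..<L} \<longrightarrow> v x = h x"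
    and t: "t \<in> {0..L}"
  shows "(u has_real_derivative h t) (at t within {0..L})"
proof -
  obtain N where N: "N \<in> null_sets lborel" "{x. \<not> (x \<in> {0<..<L} \<longrightarrow> v x = h x)} \<subseteq> N"
    using ae by (auto simp: eventually_ae_filter)
  have "negligible N"
    using N(1) by (simp add: negligible_iff_null_sets null_sets_completionI)
  then have neg: "negligible (N \<union> {0,L})" by simp
  have u: "u 0 + integral {0..x} h = u x" if x: "x \<in> {0..L}" for x
  proof -
    have "(h has_integral (u x - u 0)) {0..x}"
    proof (rule has_integral_spike[OF neg _ int[OF x]])
      fix s assume "s \<in> {0..x} - (N \<union> {0,L})"
      then have "s \<in> {0<..<L}" "s \<notin> N" using x by auto
      then show "h s = v s" using N(2) by (metis (mono_tags, lifting) mem_Collect_eq subsetD)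
    qed
    then show ?thesis by (simp add: integral_unique)
  qed
  have "((\<lambda>x. u 0 + integral {0..x} h) has_real_derivative 0 + h t) (at t within {0..L})"
    by (intro DERIV_add DERIV_const integral_has_real_derivative[OF h t])
  then have "((\<lambda>x. u 0 + integral {0..x} h) has_real_derivative h t) (at t within {0..L})"
    by simp
  then show ?thesis
    by (rule has_field_derivative_transform_within[where d=1]) (use t u in auto)
qed

text \<open>This includes the end points: in a nondegenerate closed interval one-sided derivatives
  are unique too.\<close>

lemma has_real_derivative_const_imp_zero:
  assumes "(u has_real_derivative D) (at t within {0..L})" "L > 0" "t \<in> {0..L}"
    and "\<And>x. x \<in> {0..L} \<Longrightarrow> u x = (0::real)"
  shows "D = 0"
proof -
  have "((\<lambda>x. 0) has_real_derivative D) (at t within {0..L})"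
    by (rule has_field_derivative_transform_within[OF assms(1), where d=1]) (use assms in auto)
  moreover have "((\<lambda>x. 0::real) has_real_derivative 0) (at t within {0..L})" by simp
  ultimately show ?thesis
    using vector_derivative_unique_within_closed_interval[of 0 L t "\<lambda>x. 0::real" D 0] assms(2,3)
    by (simp add: has_real_derivative_iff_has_vector_derivative)
qed

text \<open>All orders up to \<open>2*l\<close> and both end points are covered, because
  \<open>two_point_problem\<close> reads off the initial jet of a homogeneous solution.\<close>

lemma homogeneous_solution_zero:
  assumes L: "L > 0" and lam: "lam > 0" and l: "l \<ge> 2" and cc: "coeff_conditions l a b"
    and sol: "is_solution L l lam a b (\<lambda>_. 0) du"
    and k: "k < 2*l+1" and x: "x \<in> {0..L}"
  shows "du k x = 0"
proof -
  define c where "c k = (-1)^(l+1) * kdv_coeff lam k" for k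
  have "solves_ode L (2*l+1) c (\<lambda>_. 0) du"
    using sol unfolding is_solution_iff[OF l] c_def by simp
  then have sob: "sobolev_H L (2*l+1) du"
    and ae: "AE x in lborel. x \<in> {0<..<L} \<longrightarrow> du (2*l+1) x + (\<Sum>k<2*l+1. c k * du k x) = 0"
    by (auto simp: solves_ode_def)
  have bc: "du 0 0 = 0" "du 0 L = 0" "du l L = 0"
    "\<And>j. 1 \<le> j \<Longrightarrow> j < l \<Longrightarrow> du (l+j) 0 = a (l+j) (l-j) * du (l-j) 0"
    "\<And>j. 1 \<le> j \<Longrightarrow> j < l \<Longrightarrow> du (l+j) L = b (l+j) (l-j) * du (l-j) L"
    using sol by (auto simp: is_solution_def)
  \<comment> \<open>Only the top derivative is replaced, by the continuous function that the
    homogeneous equation prescribes; \<open>y\<close> is then a classical jet that satisfies the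
    equation everywhere.\<close>
  define y where "y k = (if k < 2*l+1 then du k else (\<lambda>x. - (\<Sum>k<2*l+1. c k * du k x)))" for k
  have duc: "continuous_on {0..L} (du k)" if "k < 2*l+1" for k
    using sob that by (simp add: sobolev_H_def)
  have yc: "continuous_on {0..L} (y k)" for k
    unfolding y_def using duc by (auto intro!: continuous_intros simp del: sum.lessThan_Suc)
  have yd: "(y k has_real_derivative y (Suc k) t) (at t within {0..L})"
    if kl: "k \<le> 2*l" and t: "t \<in> {0..L}" for k t
  proof -
    have "(du k has_real_derivative y (Suc k) t) (at t within {0..L})"
    proof (rule primitive_of_AE_continuous_has_real_derivative[OF _ yc _ t])
      show "(du (Suc k) has_integral (du k x - du k 0)) {0..x}" if "x \<in> {0..L}" for x
        using sob kl that by (simp add: sobolev_H_def)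
      show "AE x in lborel. x \<in> {0<..<L} \<longrightarrow> du (Suc k) x = y (Suc k) x"
      proof (cases "k = 2*l")
        case True
        show ?thesis using ae
        proof eventually_elim
          case (elim x)
          then show ?case using True by (auto simp: y_def simp del: sum.lessThan_Suc)
        qed
      next
        case False
        then show ?thesis using kl by (simp add: y_def)
      qed
    qed
    then show ?thesis using kl by (simp add: y_def)
  qed
  define E where "E t = energy_form l (\<lambda>k. y k t)" for t
  have eq: "(\<Sum>j=1..l. (-1)^(j+1) * y (2*j+1) t) = - (lam * y 0 t)" for t
  proof -
    have "y (2*l+1) t + (\<Sum>k<2*l+1. c k * y k t) = (-1)^(l+1) * 0"
      by (simp add: y_def del: sum.lessThan_Suc)
    then have "lam * y 0 t + (\<Sum>j=1..l. (-1)^(j+1) * y (2*j+1) t) = 0"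
      using kdv_equation_iff[of l lam "\<lambda>k. y k t" 0] l unfolding c_def by simp
    then show ?thesis by simp
  qed
  have Ed: "(E has_real_derivative - (lam * (y 0 t)\<^sup>2)) (at t within {0..L})" if "t \<in> {0..L}" for t
  proof -
    have "(E has_real_derivative y 0 t * - (lam * y 0 t)) (at t within {0..L})"
      unfolding E_def[abs_def] eq[symmetric]
      using yd that by (intro energy_form_has_real_derivative) auto
    then show ?thesis by (simp add: power2_eq_square mult_ac)
  qed
  have Ec: "continuous_on {0..L} E"
    using Ed by (meson DERIV_continuous continuous_on_eq_continuous_within)
  have mono: "E q \<le> E p" if "0 \<le> p" "p \<le> q" "q \<le> L" for p q
  proof (cases "p = q")
    case False
    show ?thesis
    proof (rule DERIV_nonpos_imp_decreasing_open[of p q E])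
      fix t assume t: "p < t" "t < q"
      then have "at t within {0..L} = at t" using that by (intro at_within_Icc_at) auto
      then show "\<exists>D. (E has_real_derivative D) (at t) \<and> D \<le> 0"
        using Ed[of t] t that lam by (intro exI[of _ "- (lam * (y 0 t)\<^sup>2)"]) auto
    qed (use that in \<open>auto intro: continuous_on_subset[OF Ec]\<close>)
  qed simp
  have "E 0 \<le> 0"
    unfolding E_def using bc l
    by (intro energy_form_left_end[OF l cc]) (auto simp: y_def)
  moreover have "0 \<le> E L"
    unfolding E_def using bc l
    by (intro energy_form_right_end[OF l cc]) (auto simp: y_def)
  ultimately have E0: "E t = 0" if "t \<in> {0..L}" for t
    using mono[of 0 t] mono[of t L] that by auto
  have y0: "y 0 t = 0" if t: "t \<in> {0..L}" for t
  proof -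
    have "- (lam * (y 0 t)\<^sup>2) = 0"
      by (rule has_real_derivative_const_imp_zero[OF Ed[OF t] L t E0])
    then show ?thesis using lam by simp
  qed
  \<comment> \<open>Vanishing on the whole interval passes from \<open>y k\<close> to its derivative
    \<open>y (Suc k)\<close>.\<close>
  have "y k x = 0" if "k \<le> 2*l" "x \<in> {0..L}" for k x
    using that
  proof (induction k arbitrary: x)
    case 0
    then show ?case using y0 by simp
  next
    case (Suc k)
    show ?case
      by (rule has_real_derivative_const_imp_zero[OF yd L]) (use Suc in auto)
  qed
  from this[of k x] show ?thesis using k x by (simp add: y_def)
qed

theorem theorem1:
  fixes L lam :: real and l :: nat and a b :: "nat \<Rightarrow> nat \<Rightarrow> real"
  assumes "L > 0" and "lam > 0" and "l \<ge> 2" and "coeff_conditions l a b"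
  shows "\<exists>C>0. \<forall>f. L2_on L f \<longrightarrow>
           (\<exists>du. is_solution L l lam a b f du) \<and>
           (\<forall>du1 du2. is_solution L l lam a b f du1 \<and> is_solution L l lam a b f du2
               \<longrightarrow> (\<forall>x\<in>{0..L}. du1 0 x = du2 0 x)) \<and>
           (\<forall>du. is_solution L l lam a b f du \<longrightarrow>
               H_norm L (2*l+1) du \<le> C * L2_norm L f)"
proof -
  note L = assms(1) and l = assms(3)
  define n where "n = 2*l+1"
  define s :: real where "s = (-1)^(l+1)"
  have s1: "\<bar>s\<bar> = 1" "s\<^sup>2 = 1" by (auto simp: s_def power_mult[symmetric] power_abs simp del: power_Suc)
  define c where "c k = s * kdv_coeff lam k" for k
  define bc where "bc r = two_point L n (left_rows l a r) (right_rows l b r)" for r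
  have sol_iff: "is_solution L l lam a b f du \<longleftrightarrow>
      solves_ode L n c (\<lambda>x. s * f x) du \<and> (\<forall>r<n. bc r du = 0)" for f du
    using is_solution_iff[OF l] unfolding n_def c_def s_def bc_def .
  have hom: "du k x = 0" if "solves_ode L n c (\<lambda>_. 0) du" "\<And>r. r < n \<Longrightarrow> bc r du = 0"
    "k < n" "x \<in> {0..L}" for du k x
    using homogeneous_solution_zero[OF assms, of du k x] that by (simp add: sol_iff n_def)
  \<comment> \<open>Agreement of all orders below \<open>n\<close> is what later carries the uniform
    bounds of the constructed solution over to an arbitrary one.\<close>
  have uniq: "du1 k x = du2 k x"
    if "is_solution L l lam a b f du1" "is_solution L l lam a b f du2" "k < n" "x \<in> {0..L}"
    for f du1 du2 k x
  proof -
    have "1 * du1 k x + (-1) * du2 k x = 0"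
    proof (rule hom[of "\<lambda>k x. 1 * du1 k x + (-1) * du2 k x" k x])
      have "solves_ode L n c (\<lambda>x. 1 * (s * f x) + (-1) * (s * f x)) (\<lambda>k x. 1 * du1 k x + (-1) * du2 k x)"
        using that by (intro solves_ode_linear_combination) (auto simp: sol_iff)
      then show "solves_ode L n c (\<lambda>_. 0) (\<lambda>k x. 1 * du1 k x + (-1) * du2 k x)" by simp
      show "bc r (\<lambda>k x. 1 * du1 k x + (-1) * du2 k x) = 0" if "r < n" for r
        using that \<open>is_solution L l lam a b f du1\<close> \<open>is_solution L l lam a b f du2\<close>
        unfolding sol_iff bc_def two_point_linear_combination by simp
    qed (use that in auto)
    then show ?thesis by simp
  qed
  obtain K where K: "K \<ge> 0" and ex: "\<And>g. L2_on L g \<Longrightarrow> \<exists>du. solves_ode L n c g du \<and>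
           (\<forall>r<n. bc r du = 0) \<and> (\<forall>k<n. \<forall>x\<in>{0..L}. \<bar>du k x\<bar> \<le> K * L2_norm L g)"
  proof (rule two_point_problem[OF L, of n c "left_rows l a" "right_rows l b"])
    show "du k x = 0" if "solves_ode L n c (\<lambda>_. 0) du"
      "\<And>r. r < n \<Longrightarrow> two_point L n (left_rows l a r) (right_rows l b r) du = 0"
      "k < n" "x \<in> {0..L}" for du k x
      using hom[of du k x] that unfolding bc_def by blast
  qed (use that in \<open>unfold bc_def, blast\<close>)
  define D where "D = (\<Sum>k<n. \<bar>c k\<bar>)"
  have D0: "D \<ge> 0" by (simp add: D_def sum_nonneg)
  \<comment> \<open>The first two summands pay for the top derivative, bounded by \<open>|f|\<close>
    plus \<open>D\<close> times the uniform bound; each of the \<open>n\<close> lower orders pays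
    \<open>2 * K^2 * L\<close>. The \<open>2\<close> also keeps \<open>C\<close> positive.\<close>
  define C where "C = sqrt (2 + 2 * (D * K)\<^sup>2 * L + real n * (2 * K\<^sup>2 * L))"
  have rad: "0 < 2 + 2 * (D * K)\<^sup>2 * L + real n * (2 * K\<^sup>2 * L)"
    using L by (intro add_pos_nonneg) auto
  have main: "\<exists>du. is_solution L l lam a b f du"
    "is_solution L l lam a b f du \<Longrightarrow> H_norm L n du \<le> C * L2_norm L f"
    if f: "L2_on L f" for f du
  proof -
    define N where "N = L2_norm L f"
    have N0: "N \<ge> 0" by (simp add: N_def L2_norm_nonneg)
    have sN: "L2_norm L (\<lambda>x. s * f x) = N"
      by (simp add: N_def L2_norm_def power_mult_distrib s1)
    have "L2_on L (\<lambda>x. s * f x + 0 * f x)" by (intro L2_on_linear_combination f)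
    then have "L2_on L (\<lambda>x. s * f x)" by simp
    from ex[OF this] obtain dv where dv: "is_solution L l lam a b f dv"
      and dvb: "\<And>k x. k < n \<Longrightarrow> x \<in> {0..L} \<Longrightarrow> \<bar>dv k x\<bar> \<le> K * N"
      unfolding sol_iff sN by blast
    show "\<exists>du. is_solution L l lam a b f du" using dv by blast
    assume du: "is_solution L l lam a b f du"
    have dub: "\<bar>du k x\<bar> \<le> K * N" if "k < n" "x \<in> {0..L}" for k x
      using uniq[OF du dv that] dvb[OF that] by simp
    have sob: "sobolev_H L n du" using du by (simp add: sol_iff solves_ode_def)
    have low: "(L2_norm L (du k))\<^sup>2 \<le> 2 * K\<^sup>2 * L * N\<^sup>2" if "k < n" for k
    proof -
      have "L2_on L (du k)"
        using sob that by (intro continuous_on_imp_L2_on) (simp add: sobolev_H_def)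
      moreover have "L2_on L (\<lambda>_. 0)" by (intro continuous_on_imp_L2_on) auto
      ultimately have "(L2_norm L (du k))\<^sup>2 \<le> 2 * (L2_norm L (\<lambda>_. 0))\<^sup>2 + 2 * (K * N)\<^sup>2 * L"
        using L K N0 dub that by (intro L2_norm_square_le) auto
      then show ?thesis by (simp add: L2_norm_square power_mult_distrib mult_ac set_lebesgue_integral_def)
    qed
    have top: "(L2_norm L (du n))\<^sup>2 \<le> 2 * N\<^sup>2 + 2 * (D * (K * N))\<^sup>2 * L"
      unfolding N_def
    proof (rule L2_norm_square_le[OF _ sobolev_H_L2_on[OF sob] f])
      have "AE x in lborel. x \<in> {0<..<L} \<longrightarrow> du n x + (\<Sum>k<n. c k * du k x) = s * f x"
        using du by (simp add: sol_iff solves_ode_def)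
      \<comment> \<open>The equation is stated on the open interval and the norm is taken on the
        closed one; the two end points form a null set.\<close>
      moreover have "AE x in lborel. x \<noteq> 0" "AE x in lborel. x \<noteq> L"
        by (auto intro: AE_lborel_singleton)
      ultimately show "AE x in lborel. x \<in> {0..L} \<longrightarrow> \<bar>du n x\<bar> \<le> \<bar>f x\<bar> + D * (K * L2_norm L f)"
      proof eventually_elim
        case (elim x)
        show ?case
        proof
          assume x: "x \<in> {0..L}"
          have "\<bar>\<Sum>k<n. c k * du k x\<bar> \<le> (\<Sum>k<n. \<bar>c k * du k x\<bar>)" by (rule sum_abs)
          also have "\<dots> \<le> (\<Sum>k<n. \<bar>c k\<bar> * (K * N))"
            unfolding abs_mult using dub x by (intro sum_mono mult_left_mono) auto
          also have "\<dots> = D * (K * N)" by (simp add: D_def sum_distrib_right)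
          finally have "\<bar>\<Sum>k<n. c k * du k x\<bar> \<le> D * (K * N)" .
          moreover have "\<bar>s * f x\<bar> = \<bar>f x\<bar>" by (simp add: abs_mult s1)
          moreover have "du n x + (\<Sum>k<n. c k * du k x) = s * f x" using elim x by auto
          ultimately show "\<bar>du n x\<bar> \<le> \<bar>f x\<bar> + D * (K * L2_norm L f)" unfolding N_def by linarith
        qed
      qed
    qed (use L D0 K L2_norm_nonneg in auto)
    have "(\<Sum>j\<le>n. (L2_norm L (du j))\<^sup>2) = (\<Sum>j<n. (L2_norm L (du j))\<^sup>2) + (L2_norm L (du n))\<^sup>2"
      by (simp add: lessThan_Suc_atMost[symmetric])
    also have "\<dots> \<le> (\<Sum>j<n. 2 * K\<^sup>2 * L * N\<^sup>2) + (2 * N\<^sup>2 + 2 * (D * (K * N))\<^sup>2 * L)"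
      using low top by (intro add_mono sum_mono) auto
    also have "\<dots> = (2 + 2 * (D * K)\<^sup>2 * L + real n * (2 * K\<^sup>2 * L)) * N\<^sup>2"
      by (simp add: power_mult_distrib algebra_simps)
    finally have "H_norm L n du \<le> sqrt ((2 + 2 * (D * K)\<^sup>2 * L + real n * (2 * K\<^sup>2 * L)) * N\<^sup>2)"
      unfolding H_norm_def by (rule real_sqrt_le_mono)
    also have "\<dots> = C * N" using N0 by (simp add: C_def real_sqrt_mult)
    finally show "H_norm L n du \<le> C * L2_norm L f" by (simp add: N_def)
  qed
  have "0 < n" by (simp add: n_def)
  show ?thesis
  proof (intro exI[of _ C] conjI allI impI ballI)
    show "C > 0" using rad by (simp add: C_def)
    show "\<exists>du. is_solution L l lam a b f du" if "L2_on L f" for f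
      using main(1)[OF that] .
    show "du1 0 x = du2 0 x" if "is_solution L l lam a b f du1 \<and> is_solution L l lam a b f du2"
      "x \<in> {0..L}" for f du1 du2 x
      using that \<open>0 < n\<close> by (intro uniq) auto
    show "H_norm L (2*l+1) du \<le> C * L2_norm L f" if "L2_on L f" "is_solution L l lam a b f du" for f du
      using main(2)[OF that] by (simp add: n_def)
  qed
qed

end
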